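(* Let $T>0$, $\alpha,\beta,\lambda>0$, $p\ge1$, and assume $\gamma$ is sufficiently large. Let $f^k=f(t_k)$ and $g^k=g(t_k)$, $k=1,\dots,K$, and let $(u_h^k)_{0\le k\le K}$ be the solution of the fully discrete scheme (FD) (see context). Then $$\|u_h^K\|^2_{L^2_\lambda(\Omega,\Gamma_1)}+\Delta t\sum_{k=1}^K|||u_h^k|||_*^2\lesssim\|u_{h0}\|^2_{L^2_\lambda(\Omega,\Gamma_1)}+\Delta t\sum_{k=1}^K\Big(\|f^k\|^2_{L^2(\Omega)}+\|g^k\|^2_{L^2(\Gamma_1)}\Big).$$
   Context: Convention: $x\lesssim y$ means $x\le Cy$ with a constant $C>0$ independent of the discretization parameters $h,\Delta t$ (and of the functions and data involved). "$\gamma$ sufficiently large" means: there is $\gamma_0>0$ independent of $h,\Delta t$ such that the assertion holds for each fixed $\gamma\ge\gamma_0$. Domain. $\Omega=(a,b)\times(c,d)\subset\mathbb R^2$; $\Gamma_1$ is the union of the top and bottom edges of $\partial\Omega$, and $\Gamma_2=\Gamma_2^+\cup\Gamma_2^-$ the union of the left and right edges, with $\Gamma_2^+$ identified with $\Gamma_2^-$ (periodic boundary conditions). $\mathbf n$ is the outward unit normal, $\nabla_\Gamma v=(\mathbf I-\mathbf n\otimes\mathbf n)\nabla v$ the tangential gradient. $\|v\|^2_{L^2_\lambda(\Omega,\Gamma_1)}=\|v\|^2_{L^2(\Omega)}+\lambda\|v|_{\Gamma_1}\|^2_{L^2(\Gamma_1)}$. Data: $f\in C([0,T];L^2(\Omega))$,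 $g\in C([0,T];L^2(\Gamma_1))$, $u_0\in L^2(\Omega)$. Mesh. $\mathcal T_h$ is a quasi-uniform (conforming) partition of $\Omega$ into disjoint open triangles, matching under the periodic identification of $\Gamma_2^\pm$; $h=\max_T\mathrm{diam}(T)$. $V^p(\mathcal T_h)=\{v\in L^2(\Omega):v|_T\in\mathbb P^p(T)\ \forall T\in\mathcal T_h\}$. $|v|^2_{H^1(\mathcal T_h)}=\sum_T|v|^2_{H^1(T)}$. $\mathcal E_h^0$: interior edges; $\mathcal E_h^{\Gamma_2}$: periodic edges (edges on $\Gamma_2^+$ identified with those on $\Gamma_2^-$, each shared by two triangles $T^\pm$); $\mathcal E_h^{\Gamma_1}$: edges on $\Gamma_1$; $\mathcal R_h^{\Gamma_1}$: ridges, i.e. mesh vertices on $\Gamma_1$, corner vertices being identified by periodicity, so each ridge is shared by two edges $e^\pm\in\mathcal E_h^{\Gamma_1}$. On $e\in\mathcal E_h^0\cup\mathcal E_h^{\Gamma_2}$: $[v]=v^+\mathbf n^++v^-\mathbf n^-$, $\{v\}=\tfrac12(v^++v^-)$ with $v^\pm=v|_{T^\pm}$ and $\mathbf n^\pm$ the unit normal to $e$ outward to $T^\pm$. On a ridge $r$: $[v]=v^+(r)\mathbf n_r^++v^-(r)\mathbf n_r^-$, $\{v\}=\tfrac12(v^+(r)+v^-(r))$ with $v^\pm=v|_{e^\pm}$ and $\mathbf n_r^\pm$ the unit tangent vector to $\Gamma_1$ at $r$ pointing outward of $e^\pm$. Averages extend componentwise to vector fields. Inner products and squared $L^2$ norms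 over a set of edges are sums over the edges; over $\mathcal R_h^{\Gamma_1}$ they are sums of point values. $|v|^2_{H^1(\mathcal E_h^{\Gamma_1})}=\sum_{e\in\mathcal E_h^{\Gamma_1}}|v|^2_{H^1(e)}$. Forms and norm. $\sigma=\gamma/h$ with $\gamma>0$ constant. With $\mathcal E_*=\mathcal E_h^0\cup\mathcal E_h^{\Gamma_2}$, $$\mathcal B_h(v,w)=\sum_T(\nabla v,\nabla w)_T-([v],\{\nabla w\})_{\mathcal E_*}-([w],\{\nabla v\})_{\mathcal E_*}+\sigma([v],[w])_{\mathcal E_*},$$ $$b_h(v,w)=(\nabla_\Gamma v,\nabla_\Gamma w)_{\mathcal E_h^{\Gamma_1}}-([v],\{\nabla_\Gamma w\})_{\mathcal R_h^{\Gamma_1}}-([w],\{\nabla_\Gamma v\})_{\mathcal R_h^{\Gamma_1}}+\sigma([v],[w])_{\mathcal R_h^{\Gamma_1}},$$ $$\mathcal A_h(v,w)=\mathcal B_h(v,w)+\alpha(v,w)_{L^2(\Gamma_1)}+\beta b_h(v,w),$$ $$|||w|||_*^2=|w|^2_{H^1(\mathcal T_h)}+\sigma\|[w]\|^2_{L^2(\mathcal E_* )}+\tfrac1\sigma\|\{\nabla w\}\|^2_{L^2(\mathcal E_* )}+\alpha\|w\|^2_{L^2(\Gamma_1)}+\beta|w|^2_{H^1(\mathcal E_h^{\Gamma_1})}+\beta\sigma\|[w]\|^2_{L^2(\mathcal R_h^{\Gamma_1})}+\tfrac\beta\sigma\|\{\nabla_\Gamma w\}\|^2_{L^2(\mathcal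 R_h^{\Gamma_1})}.$$ Scheme (FD). $\Delta t>0$, $t_k=k\Delta t$, $K=T/\Delta t$ an integer. Given $u_h^0=u_{h0}\in V^p(\mathcal T_h)$, the $L^2$-projection of $u_0$ into $V^p(\mathcal T_h)$, find $u_h^{k+1}\in V^p(\mathcal T_h)$, $0\le k\le K-1$, such that for all $v_h\in V^p(\mathcal T_h)$ $$\Big(\tfrac{u_h^{k+1}-u_h^k}{\Delta t},v_h\Big)_{L^2(\Omega)}+\lambda\Big(\tfrac{u_h^{k+1}-u_h^k}{\Delta t},v_h\Big)_{L^2(\Gamma_1)}+\mathcal A_h(u_h^{k+1},v_h)=(f(t_{k+1}),v_h)_{L^2(\Omega)}+(g(t_{k+1}),v_h)_{L^2(\Gamma_1)}.$$ *)

theory Defs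
  imports "HOL-Analysis.Analysis"
begin

type_synonym point = "real \<times> real"

section \<open>Function spaces and traces\<close>

definition L2 :: "'a measure \<Rightarrow> ('a \<Rightarrow> real) set" where
  "L2 M = {\<phi>. \<phi> \<in> borel_measurable M \<and> integrable M (\<lambda>x. (\<phi> x)\<^sup>2)}"

definition ip :: "'a measure \<Rightarrow> ('a \<Rightarrow> real) \<Rightarrow> ('a \<Rightarrow> real) \<Rightarrow> real" where
  "ip M \<phi> \<psi> = (LINT x|M. \<phi> x * \<psi> x)"

text \<open>\<open>C([0,T]; X)\<close> for a function space \<open>X\<close> whose squared norm is \<open>nsq\<close>.\<close>

definition C_into ::
  "real \<Rightarrow> ('a \<Rightarrow> real) set \<Rightarrow> (('a \<Rightarrow> real) \<Rightarrow> real) \<Rightarrow> (real \<Rightarrow> 'a \<Rightarrow> real) set" where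
  "C_into T X nsq = {f. (\<forall>t\<in>{0..T}. f t \<in> X) \<and>
     (\<forall>t\<in>{0..T}. ((\<lambda>s. nsq (\<lambda>x. f s x - f t x)) \<longlongrightarrow> 0) (at t within {0..T}))}"

text \<open>Polynomials in two variables of total degree at most \<open>p\<close>.\<close>

definition Poly2 :: "nat \<Rightarrow> (point \<Rightarrow> real) set" where
  "Poly2 p = {q. \<exists>k :: nat \<Rightarrow> nat \<Rightarrow> real.
     q = (\<lambda>(x, y). \<Sum>(i, j) \<in> {(i, j). i + j \<le> p}. k i j * x ^ i * y ^ j)}"

definition grad :: "(point \<Rightarrow> real) \<Rightarrow> point \<Rightarrow> point" where
  "grad v x = (\<Sum>i\<in>Basis. frechet_derivative v (at x) i *\<^sub>R i)"

text \<open>Trace on the closed triangle \<open>T\<close> of a scalar or vector field given on its interior. Elements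
  of the broken polynomial space are arbitrary on the mesh skeleton, so one-sided values there are
  always taken as limits from inside a triangle.\<close>

definition tr :: "(point \<Rightarrow> 'b::t2_space) \<Rightarrow> point set \<Rightarrow> point \<Rightarrow> 'b" where
  "tr F T x = Lim (at x within interior T) F"

text \<open>Integral with respect to arc length over a closed segment \<open>e\<close>. The choice of the endpoints is
  unique up to order, which does not affect the value; see \<open>seg_int_closed_segment\<close>.\<close>

definition seg_int :: "point set \<Rightarrow> (point \<Rightarrow> real) \<Rightarrow> real" where
  "seg_int e \<phi> = (let (P, Q) = (SOME (P, Q). e = closed_segment P Q)
     in dist P Q * (LINT s|lebesgue_on {0..1}. \<phi> (linepath P Q s)))"

lemma lebesgue_integral_reflect_unit:
  fixes F :: "real \<Rightarrow> real"
  shows "(LINT s|lebesgue_on {0..1}. F (1 - s)) = (LINT s|lebesgue_on {0..1}. F s)"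
proof -
  have *: "indicator {0..1} (1 + (-1) * s) = (indicator {0..1} s :: real)" for s :: real
    by (auto simp: indicator_def)
  have "(LINT s|lebesgue. indicator {0..1} s *\<^sub>R F s)
      = \<bar>-1\<bar> *\<^sub>R (LINT s|lebesgue. indicator {0..1} (1 + (-1) * s) *\<^sub>R F (1 + (-1) * s))"
    by (rule lebesgue_integral_real_affine) auto
  then show ?thesis
    unfolding * by (simp add: integral_restrict_space)
qed

lemma seg_int_closed_segment:
  "seg_int (closed_segment P Q) \<phi> = dist P Q * (LINT s|lebesgue_on {0..1}. \<phi> (linepath P Q s))"
proof -
  define R where "R = (SOME (P', Q'). closed_segment P Q = closed_segment P' Q')"
  obtain P' Q' where R: "R = (P', Q')" by (cases R)
  have "case R of (P', Q') \<Rightarrow> closed_segment P Q = closed_segment P' Q'"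
    unfolding R_def by (rule someI[of _ "(P, Q)"]) simp
  then have "{P, Q} = {P', Q'}"
    by (simp add: R closed_segment_eq)
  then consider "P' = P" "Q' = Q" | "P' = Q" "Q' = P"
    by (auto simp: doubleton_eq_iff)
  then show ?thesis
  proof cases
    case 1
    then show ?thesis using R by (simp add: seg_int_def R_def)
  next
    case 2
    have "linepath Q P s = linepath P Q (1 - s)" for s
      by (simp add: linepath_def)
    then have "(LINT s|lebesgue_on {0..1}. \<phi> (linepath Q P s))
        = (LINT s|lebesgue_on {0..1}. \<phi> (linepath P Q s))"
      using lebesgue_integral_reflect_unit[of "\<lambda>s. \<phi> (linepath P Q s)"] by simp
    then show ?thesis using 2 R by (simp add: seg_int_def R_def dist_commute)
  qed
qed

section \<open>Normals\<close>

definition outer_normal :: "point set \<Rightarrow> point set \<Rightarrow> point" where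
  "outer_normal T e = (THE n. norm n = 1 \<and> (\<forall>x\<in>e. \<forall>y\<in>e. n \<bullet> (x - y) = 0)
                            \<and> (\<forall>x\<in>e. \<forall>y\<in>T. n \<bullet> (y - x) \<le> 0))"

text \<open>Unit tangent to the segment \<open>e\<close> at its endpoint \<open>r\<close>, pointing out of \<open>e\<close>.\<close>

definition outer_tangent :: "point set \<Rightarrow> point \<Rightarrow> point" where
  "outer_tangent e r = (THE n. norm n = 1 \<and> (\<forall>y\<in>e. r - y = norm (r - y) *\<^sub>R n))"

section \<open>The discontinuous Galerkin setting\<close>

text \<open>The mesh \<open>Th\<close> is the set of closed triangles; the open triangles are their interiors.
  The locale makes no assumptions: it only fixes the data the notions below depend on.
  The parameter \<open>lam\<close> is the coefficient \<open>\<lambda>\<close>.\<close>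

locale dg_setting =
  fixes a b c d :: real
    and \<alpha> \<beta> lam \<gamma> :: real
    and p :: nat
    and Th :: "point set set"
begin

definition Omega :: "point set" where "Omega = {a<..<b} \<times> {c<..<d}"
definition Gamma1 :: "point set" where "Gamma1 = {a..b} \<times> {c, d}"
definition Gamma2_minus :: "point set" where "Gamma2_minus = {a} \<times> {c..d}"
definition Gamma2_plus :: "point set" where "Gamma2_plus = {b} \<times> {c..d}"

text \<open>Translation by \<open>period\<close> identifies \<open>Gamma2_minus\<close> with \<open>Gamma2_plus\<close>.\<close>

definition period :: point where "period = (b - a, 0)"

definition L2_Gamma1 :: "(point \<Rightarrow> real) set" where
  "L2_Gamma1 = {\<phi>. \<forall>y\<in>{c, d}. (\<lambda>x. \<phi> (x, y)) \<in> L2 (lebesgue_on {a..b})}"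

definition ip_Omega :: "(point \<Rightarrow> real) \<Rightarrow> (point \<Rightarrow> real) \<Rightarrow> real" where
  "ip_Omega = ip (lebesgue_on Omega)"

definition ip_Gamma1 :: "(point \<Rightarrow> real) \<Rightarrow> (point \<Rightarrow> real) \<Rightarrow> real" where
  "ip_Gamma1 \<phi> \<psi> = (\<Sum>y\<in>{c, d}. ip (lebesgue_on {a..b}) (\<lambda>x. \<phi> (x, y)) (\<lambda>x. \<psi> (x, y)))"

subsection \<open>Mesh\<close>

definition edges :: "point set set" where
  "edges = {e. \<exists>T\<in>Th. e edge_of T}"

definition conforming_mesh :: bool where
  "conforming_mesh \<longleftrightarrow>
     triangulation Th \<and> (\<forall>T\<in>Th. 2 simplex T) \<and> \<Union>Th = {a..b} \<times> {c..d} \<and>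
     image ((+) period) ` {e \<in> edges. e \<subseteq> Gamma2_minus} = {e \<in> edges. e \<subseteq> Gamma2_plus}"

definition h :: real where
  "h = Max (diameter ` Th)"

text \<open>Quasi-uniformity with constant \<open>\<rho>\<close>: the inradius of every triangle is at least \<open>\<rho> h\<close>.\<close>

definition quasi_uniform :: "real \<Rightarrow> bool" where
  "quasi_uniform \<rho> \<longleftrightarrow> (\<forall>T\<in>Th. \<exists>z. ball z (\<rho> * h) \<subseteq> T)"

definition Vp :: "(point \<Rightarrow> real) set" where
  "Vp = {v \<in> L2 (lebesgue_on Omega). \<forall>T\<in>Th. \<exists>q\<in>Poly2 p. \<forall>x\<in>interior T. v x = q x}"

definition E0 :: "point set set" where
  "E0 = {e \<in> edges. e \<inter> Omega \<noteq> {}}"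

text \<open>A periodic edge is represented by its copy on \<open>Gamma2_minus\<close>.\<close>

definition E_Gamma2 :: "point set set" where
  "E_Gamma2 = {e \<in> edges. e \<subseteq> Gamma2_minus}"

definition E_star :: "point set set" where
  "E_star = E0 \<union> E_Gamma2"

definition E_Gamma1 :: "point set set" where
  "E_Gamma1 = {e \<in> edges. e \<subseteq> Gamma1}"

text \<open>The two corner vertices on the top (bottom) edge form one ridge, represented by the left one.\<close>

definition ridges :: "point set" where
  "ridges = {r \<in> Gamma1. fst r < b \<and> (\<exists>T\<in>Th. r extreme_point_of T)}"

subsection \<open>Jumps and averages\<close>

text \<open>The two sides \<open>T\<^sup>\<plusminus>\<close> of an edge in \<open>E_star\<close>: a pair \<open>(T, s)\<close> consists of a triangle and the
  translation that takes the representing edge to an edge of \<open>T\<close>. The translation \<open>s = period\<close>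
  occurs precisely for one of the two sides of a periodic edge. The definitions of jump and average
  are symmetric in the two sides.\<close>

definition sides :: "point set \<Rightarrow> (point set \<times> point) set" where
  "sides e = {(T, s). T \<in> Th \<and> s \<in> {0, period} \<and> ((+) s ` e) edge_of T}"

definition jump :: "(point \<Rightarrow> real) \<Rightarrow> point set \<Rightarrow> point \<Rightarrow> point" where
  "jump v e x = (\<Sum>(T, s)\<in>sides e. tr v T (s + x) *\<^sub>R outer_normal T ((+) s ` e))"

definition avg :: "(point \<Rightarrow> point) \<Rightarrow> point set \<Rightarrow> point \<Rightarrow> point" where
  "avg F e x = (1/2) *\<^sub>R (\<Sum>(T, s)\<in>sides e. tr F T (s + x))"

text \<open>The triangle adjacent to an edge on \<open>Gamma1\<close>.\<close>

definition tri :: "point set \<Rightarrow> point set" where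
  "tri e = (THE T. T \<in> Th \<and> e edge_of T)"

text \<open>The trace \<open>v|\<^bsub>\<Gamma>\<^sub>1\<^esub>\<close>. It is not meaningful at ridges where \<open>v\<close> jumps, a null set of \<open>Gamma1\<close>.\<close>

definition tr_Gamma1 :: "(point \<Rightarrow> real) \<Rightarrow> point \<Rightarrow> real" where
  "tr_Gamma1 v x = Lim (at x within (\<Union>T\<in>Th. interior T)) v"

text \<open>\<open>(I - n \<otimes> n) \<nabla>v\<close> on an edge \<open>e\<close> on \<open>Gamma1\<close>.\<close>

definition tgrad :: "(point \<Rightarrow> real) \<Rightarrow> point set \<Rightarrow> point \<Rightarrow> point" where
  "tgrad v e x = (let n = outer_normal (tri e) e; G = tr (grad v) (tri e) x
                  in G - (n \<bullet> G) *\<^sub>R n)"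

text \<open>The two edges \<open>e\<^sup>\<plusminus>\<close> sharing a ridge, again with the periodic translation. If the top (bottom)
  of the rectangle is a single edge, then it is both \<open>e\<^sup>+\<close> and \<open>e\<^sup>-\<close> for its only ridge, and its two
  ends are distinguished by the translation.\<close>

definition ridge_sides :: "point \<Rightarrow> (point set \<times> point) set" where
  "ridge_sides r = {(e, s). e \<in> E_Gamma1 \<and> s \<in> {0, period} \<and> (s + r) extreme_point_of e}"

definition ridge_jump :: "(point \<Rightarrow> real) \<Rightarrow> point \<Rightarrow> point" where
  "ridge_jump v r = (\<Sum>(e, s)\<in>ridge_sides r. tr v (tri e) (s + r) *\<^sub>R outer_tangent e (s + r))"

definition ridge_avg_tgrad :: "(point \<Rightarrow> real) \<Rightarrow> point \<Rightarrow> point" where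
  "ridge_avg_tgrad v r = (1/2) *\<^sub>R (\<Sum>(e, s)\<in>ridge_sides r. tgrad v e (s + r))"

subsection \<open>Forms and norms\<close>

definition \<sigma> :: real where
  "\<sigma> = \<gamma> / h"

definition B_form :: "(point \<Rightarrow> real) \<Rightarrow> (point \<Rightarrow> real) \<Rightarrow> real" where
  "B_form v w =
     (\<Sum>T\<in>Th. LINT x|lebesgue_on (interior T). grad v x \<bullet> grad w x)
     - (\<Sum>e\<in>E_star. seg_int e (\<lambda>x. jump v e x \<bullet> avg (grad w) e x))
     - (\<Sum>e\<in>E_star. seg_int e (\<lambda>x. jump w e x \<bullet> avg (grad v) e x))
     + \<sigma> * (\<Sum>e\<in>E_star. seg_int e (\<lambda>x. jump v e x \<bullet> jump w e x))"

definition b_form :: "(point \<Rightarrow> real) \<Rightarrow> (point \<Rightarrow> real) \<Rightarrow> real" where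
  "b_form v w =
     (\<Sum>e\<in>E_Gamma1. seg_int e (\<lambda>x. tgrad v e x \<bullet> tgrad w e x))
     - (\<Sum>r\<in>ridges. ridge_jump v r \<bullet> ridge_avg_tgrad w r)
     - (\<Sum>r\<in>ridges. ridge_jump w r \<bullet> ridge_avg_tgrad v r)
     + \<sigma> * (\<Sum>r\<in>ridges. ridge_jump v r \<bullet> ridge_jump w r)"

definition A_form :: "(point \<Rightarrow> real) \<Rightarrow> (point \<Rightarrow> real) \<Rightarrow> real" where
  "A_form v w = B_form v w + \<alpha> * ip_Gamma1 (tr_Gamma1 v) (tr_Gamma1 w) + \<beta> * b_form v w"

definition star_norm_sq :: "(point \<Rightarrow> real) \<Rightarrow> real" where
  "star_norm_sq w =
     (\<Sum>T\<in>Th. LINT x|lebesgue_on (interior T). (norm (grad w x))\<^sup>2)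
     + \<sigma> * (\<Sum>e\<in>E_star. seg_int e (\<lambda>x. (norm (jump w e x))\<^sup>2))
     + 1 / \<sigma> * (\<Sum>e\<in>E_star. seg_int e (\<lambda>x. (norm (avg (grad w) e x))\<^sup>2))
     + \<alpha> * ip_Gamma1 (tr_Gamma1 w) (tr_Gamma1 w)
     + \<beta> * (\<Sum>e\<in>E_Gamma1. seg_int e (\<lambda>x. (norm (tgrad w e x))\<^sup>2))
     + \<beta> * \<sigma> * (\<Sum>r\<in>ridges. (norm (ridge_jump w r))\<^sup>2)
     + \<beta> / \<sigma> * (\<Sum>r\<in>ridges. (norm (ridge_avg_tgrad w r))\<^sup>2)"

definition L2lam_norm_sq :: "(point \<Rightarrow> real) \<Rightarrow> real" where
  "L2lam_norm_sq v = ip_Omega v v + lam * ip_Gamma1 (tr_Gamma1 v) (tr_Gamma1 v)"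

subsection \<open>The fully discrete scheme\<close>

definition L2_projection :: "(point \<Rightarrow> real) \<Rightarrow> (point \<Rightarrow> real) \<Rightarrow> bool" where
  "L2_projection u0 uh0 \<longleftrightarrow> uh0 \<in> Vp \<and> (\<forall>v\<in>Vp. ip_Omega uh0 v = ip_Omega u0 v)"

definition fd_solution ::
  "real \<Rightarrow> nat \<Rightarrow> (real \<Rightarrow> point \<Rightarrow> real) \<Rightarrow> (real \<Rightarrow> point \<Rightarrow> real) \<Rightarrow> (point \<Rightarrow> real) \<Rightarrow>
   (nat \<Rightarrow> point \<Rightarrow> real) \<Rightarrow> bool" where
  "fd_solution dt K f g u0 u \<longleftrightarrow>
     L2_projection u0 (u 0) \<and>
     (\<forall>k<K. u (Suc k) \<in> Vp \<and>
        (\<forall>v\<in>Vp.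
           ip_Omega (\<lambda>x. (u (Suc k) x - u k x) / dt) v
           + lam * ip_Gamma1 (tr_Gamma1 (\<lambda>x. (u (Suc k) x - u k x) / dt)) (tr_Gamma1 v)
           + A_form (u (Suc k)) v
           = ip_Omega (f (real (Suc k) * dt)) v
             + ip_Gamma1 (g (real (Suc k) * dt)) (tr_Gamma1 v)))"

end

end

theory Submission
  imports Defs "HOL-Computational_Algebra.Polynomial"
begin

text \<open>
  The estimate is the discrete energy inequality of the implicit Euler method, and its only nontrivial
  ingredient is the coercivity of \<open>A_form\<close> with respect to the full norm \<open>star_norm_sq\<close>, with a
  constant that does not depend on the mesh (\<open>A_form_coercive\<close>).

  For coercivity the two consistency terms \<open>([v], {\<nabla>v})\<close> must be absorbed. Young's inequality splits
  them into a part of the penalty \<open>\<sigma> \<parallel>[v]\<parallel>\<^sup>2\<close> and a multiple of \<open>\<parallel>{\<nabla>v}\<parallel>\<^sup>2 / \<sigma>\<close>, and an inverse trace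
  inequality bounds \<open>\<parallel>{\<nabla>v}\<parallel>\<^sup>2\<close> by \<open>C / h\<close> times the broken energy. As \<open>1 / \<sigma> = h / \<gamma>\<close>, a large \<open>\<gamma>\<close>
  makes this contribution small (\<open>symmetric_penalty_coercive\<close>); the same argument applies to
  \<open>b_form\<close>, one dimension lower.

  The inverse trace inequality comes from one variable. A polynomial of degree \<open>p\<close> on
  an interval of length \<open>h\<close> is bounded pointwise by its mean square over any part of comparable length
  (\<open>inverse_inequality_1d\<close>); applying this in both coordinates gives a pointwise bound on a square
  of size \<open>h\<close> by the mean square over a smaller concentric one (\<open>inverse_inequality_2d\<close>). By
  quasi-uniformity the small square fits into each triangle, which in turn lies in the large one, so
  \<open>|\<nabla>v|\<^sup>2 \<le> C / h\<^sup>2 \<integral> |\<nabla>v|\<^sup>2\<close> on the closed triangle, and integration over an edge of length at most \<open>h\<close>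
  yields the claim (\<open>edge_avg_bound\<close>). Ridges need, in addition, that boundary edges are not too
  short (\<open>edge_length_ge\<close>). How often a triangle or edge is counted in the sums is controlled by comparing
  areas (\<open>card_elems_at_point\<close>).

  Traces are limits, so it has to be shown that they are the expected polynomials. On \<open>Gamma1\<close> this rests on
  the fact that away from the vertices one triangle fills a neighbourhood of the point within the
  rectangle (\<open>boundary_neighbourhood\<close>).

  Testing the scheme with \<open>u (Suc k)\<close> then gives an inequality in which the sources leave a term
  \<open>L2lam_norm_sq (u (Suc k)) / (4 T)\<close> on the right. Since the steps add up to \<open>T\<close>, its sum is absorbed by the
  maximum over all times (\<open>discrete_energy_estimate\<close>), whatever the size of the time step.
\<close>

section \<open>Inverse inequalities for polynomials\<close>

lemma continuous_on_poly_sq: "continuous_on S (\<lambda>t. (poly P t :: real)\<^sup>2)"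
  by (intro continuous_intros)

lemma poly_sq_integrable: "(\<lambda>t. (poly P t :: real)\<^sup>2) integrable_on {l..u}"
  by (intro integrable_continuous_interval continuous_on_poly_sq)

lemma exists_le_mean:
  fixes f :: "real \<Rightarrow> real"
  assumes "continuous_on {l..u} f" "l < u"
  obtains x where "x \<in> {l..u}" "(u - l) * f x \<le> integral {l..u} f"
proof -
  obtain x where x: "x \<in> {l..u}" and min: "\<And>y. y \<in> {l..u} \<Longrightarrow> f x \<le> f y"
    using continuous_attains_inf[of "{l..u}" f] assms by auto
  have "integral {l..u} (\<lambda>_. f x) \<le> integral {l..u} f"
    by (intro integral_le integrable_continuous_interval assms) (auto simp: min)
  then show thesis using that x assms(2) by simp
qed

text \<open>An instance of the equivalence of norms on polynomials of degree at most \<open>p\<close>, by induction on the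
  degree: choose \<open>x0\<close> in the left third of the interval where \<open>P\<close> is at
  most as large as its root mean square there, and write \<open>P = P(x0) + (X - x0) Q\<close>. On the right third
  \<open>t - x0\<close> is bounded away from \<open>0\<close>, so \<open>Q\<close> inherits an integral bound from \<open>P\<close> there, and the
  induction hypothesis on that third controls \<open>Q\<close> pointwise.\<close>

lemma poly_sq_le_integral:
  fixes l u R :: real
  assumes "l < u"
  shows "\<exists>C>0. \<forall>P. degree P \<le> p \<longrightarrow>
    (\<forall>x\<in>{-R..R}. (poly P x)\<^sup>2 \<le> C * integral {l..u} (\<lambda>t. (poly P t)\<^sup>2))"
  using assms
proof (induction p arbitrary: l u)
  case 0
  have "(poly P x)\<^sup>2 \<le> 1 / (u - l) * integral {l..u} (\<lambda>t. (poly P t)\<^sup>2)"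
    if "degree P \<le> 0" for P :: "real poly" and x
  proof -
    have "degree P = 0" using that by simp
    then obtain k where "P = [:k:]" by (rule degree_eq_zeroE)
    then show ?thesis using 0 by simp
  qed
  then show ?case using 0 by (intro exI[of _ "1 / (u - l)"]) auto
next
  case (Suc p)
  define \<delta> where "\<delta> = (u - l) / 3"
  define l' u' where "l' = l + \<delta>" and "u' = u - \<delta>"
  have \<delta>: "\<delta> > 0" "l < l'" "l' < u'" "u' < u" "u' - l' = \<delta>" "l' - l = \<delta>" "u - u' = \<delta>"
    using Suc.prems by (auto simp: \<delta>_def l'_def u'_def field_simps)
  obtain C where C: "C > 0" and IH: "\<And>P x. degree P \<le> p \<Longrightarrow> x \<in> {-R..R} \<Longrightarrow>
      (poly P x)\<^sup>2 \<le> C * integral {u'..u} (\<lambda>t. (poly P t)\<^sup>2)"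
    using Suc.IH[OF \<delta>(4)] by blast
  define M where "M = R + \<bar>l\<bar> + \<bar>u\<bar>"
  define D where "D = 2 / \<delta> + 2 * M\<^sup>2 * (C * (4 / \<delta>\<^sup>2))"
  have "D > 0" unfolding D_def using C \<delta>(1) by (intro add_pos_nonneg) auto
  have "(poly P x)\<^sup>2 \<le> D * integral {l..u} (\<lambda>t. (poly P t)\<^sup>2)"
    if P: "degree P \<le> Suc p" and x: "x \<in> {-R..R}" for P x
  proof -
    define I where "I = integral {l..u} (\<lambda>t. (poly P t)\<^sup>2)"
    have sub: "integral {s..t} (\<lambda>t. (poly P t)\<^sup>2) \<le> I" if "{s..t} \<subseteq> {l..u}" for s t
      unfolding I_def using that by (intro integral_subset_le poly_sq_integrable) auto
    obtain x0 where x0: "x0 \<in> {l..l'}" and "(l' - l) * (poly P x0)\<^sup>2 \<le> integral {l..l'} (\<lambda>t. (poly P t)\<^sup>2)"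
      using exists_le_mean[OF continuous_on_poly_sq \<delta>(2)] by blast
    then have "\<delta> * (poly P x0)\<^sup>2 \<le> I" using sub[of l l'] \<delta> by force
    then have small: "(poly P x0)\<^sup>2 \<le> I / \<delta>" using \<delta>(1) by (simp add: field_simps)
    define Q where "Q = synthetic_div P x0"
    have Q: "degree Q \<le> p" using P by (simp add: Q_def degree_synthetic_div)
    have PQ: "poly P t = poly P x0 + (t - x0) * poly Q t" for t
    proof -
      have "P = [:-x0, 1:] * Q + [:poly P x0:]"
        using synthetic_div_correct'[of x0 P] by (simp add: Q_def)
      then have "poly P t = poly ([:-x0, 1:] * Q + [:poly P x0:]) t" by simp
      then show ?thesis by (simp add: algebra_simps)
    qed
    have Qt: "(poly Q t)\<^sup>2 \<le> 2 / \<delta>\<^sup>2 * (poly P t)\<^sup>2 + 2 / \<delta>\<^sup>2 * (I / \<delta>)" if t: "t \<in> {u'..u}" for t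
    proof -
      have "\<delta> \<le> t - x0" using t x0 \<delta> by auto
      then have "\<delta>\<^sup>2 * (poly Q t)\<^sup>2 \<le> (t - x0)\<^sup>2 * (poly Q t)\<^sup>2"
        using \<delta> by (intro mult_right_mono power_mono) auto
      also have "\<dots> = (poly P t - poly P x0)\<^sup>2" using PQ[of t] by (simp add: power_mult_distrib)
      also have "\<dots> \<le> 2 * (poly P t)\<^sup>2 + 2 * (poly P x0)\<^sup>2"
        using sum_squares_bound[of "poly P t" "- poly P x0"] by (simp add: power2_diff)
      also have "\<dots> \<le> 2 * (poly P t)\<^sup>2 + 2 * (I / \<delta>)" using small by simp
      finally show ?thesis using \<delta>(1) by (simp add: field_simps)
    qed
    have "integral {u'..u} (\<lambda>t. (poly Q t)\<^sup>2)
        \<le> integral {u'..u} (\<lambda>t. 2 / \<delta>\<^sup>2 * (poly P t)\<^sup>2 + 2 / \<delta>\<^sup>2 * (I / \<delta>))"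
      by (intro integral_le Qt integrable_continuous_interval continuous_intros)
    also have "\<dots> = 2 / \<delta>\<^sup>2 * integral {u'..u} (\<lambda>t. (poly P t)\<^sup>2) + 2 / \<delta>\<^sup>2 * I"
      using \<delta> by (subst integral_add)
        (auto intro!: integrable_continuous_interval continuous_intros simp: field_simps)
    also have "\<dots> \<le> 2 / \<delta>\<^sup>2 * I + 2 / \<delta>\<^sup>2 * I"
      using sub[of u' u] \<delta> by (intro add_mono mult_left_mono) auto
    finally have "integral {u'..u} (\<lambda>t. (poly Q t)\<^sup>2) \<le> 4 / \<delta>\<^sup>2 * I" by simp
    then have Qx: "(poly Q x)\<^sup>2 \<le> C * (4 / \<delta>\<^sup>2 * I)"
      using IH[OF Q x] C by (meson order_trans mult_left_mono less_imp_le)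
    have "\<bar>x - x0\<bar> \<le> \<bar>M\<bar>" using x x0 \<delta> by (auto simp: M_def)
    then have M: "(x - x0)\<^sup>2 \<le> M\<^sup>2" by (simp add: abs_le_square_iff)
    have "(poly P x)\<^sup>2 \<le> 2 * (poly P x0)\<^sup>2 + 2 * ((x - x0)\<^sup>2 * (poly Q x)\<^sup>2)"
      using sum_squares_bound[of "poly P x0" "(x - x0) * poly Q x"] PQ[of x]
      by (simp add: power2_sum power_mult_distrib)
    also have "\<dots> \<le> 2 * (I / \<delta>) + 2 * (M\<^sup>2 * (C * (4 / \<delta>\<^sup>2 * I)))"
      using small M Qx by (intro add_mono mult_left_mono mult_mono) auto
    also have "\<dots> = D * I" by (simp add: D_def algebra_simps)
    finally show ?thesis by (simp add: I_def)
  qed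
  then show ?case using \<open>D > 0\<close> by blast
qed

text \<open>A constant that depends on \<open>p\<close> and \<open>r\<close> alone is fixed once, so that all constants below are visibly
  independent of the mesh.\<close>

definition inverse_constant :: "nat \<Rightarrow> real \<Rightarrow> real" where
  "inverse_constant p r = (SOME C. C > 0 \<and> (\<forall>P. degree P \<le> p \<longrightarrow>
    (\<forall>x\<in>{-1..1}. (poly P x)\<^sup>2 \<le> C * integral {-r..r} (\<lambda>t. (poly P t)\<^sup>2))))"

lemma
  assumes "r > 0"
  shows inverse_constant_pos: "inverse_constant p r > 0"
    and inverse_constant_unit: "degree P \<le> p \<Longrightarrow> x \<in> {-1..1} \<Longrightarrow>
      (poly P x)\<^sup>2 \<le> inverse_constant p r * integral {-r..r} (\<lambda>t. (poly P t)\<^sup>2)"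
proof -
  have "- r < r" using assms by simp
  from someI_ex[OF poly_sq_le_integral[OF this, of p 1, simplified Bex_def]]
  have "inverse_constant p r > 0 \<and> (\<forall>P. degree P \<le> p \<longrightarrow>
    (\<forall>x\<in>{-1..1}. (poly P x)\<^sup>2 \<le> inverse_constant p r * integral {-r..r} (\<lambda>t. (poly P t)\<^sup>2)))"
    unfolding inverse_constant_def .
  then show "inverse_constant p r > 0"
    "degree P \<le> p \<Longrightarrow> x \<in> {-1..1} \<Longrightarrow>
      (poly P x)\<^sup>2 \<le> inverse_constant p r * integral {-r..r} (\<lambda>t. (poly P t)\<^sup>2)" by blast+
qed

text \<open>The scaled form: \<open>m\<close> and \<open>h\<close> are the centre and the size of an element, and \<open>r * h\<close> is the size of
  a part of it.\<close>

lemma inverse_inequality_1d: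
  fixes h :: real
  assumes "r > 0" "h > 0" "degree P \<le> p" "\<bar>x - m\<bar> \<le> h"
  shows "(poly P x)\<^sup>2
    \<le> inverse_constant p r / h * integral {m - r * h..m + r * h} (\<lambda>t. (poly P t)\<^sup>2)"
proof -
  define Q where "Q = pcompose P [:m, h:]"
  have Q: "poly Q t = poly P (m + h * t)" for t by (simp add: Q_def poly_pcompose mult.commute)
  have "degree Q \<le> p" using assms(2,3) by (simp add: Q_def degree_pcompose)
  moreover have "(x - m) / h \<in> {-1..1}"
    using assms by (auto simp: field_simps abs_le_iff)
  ultimately have "(poly Q ((x - m) / h))\<^sup>2 \<le> inverse_constant p r * integral {-r..r} (\<lambda>t. (poly Q t)\<^sup>2)"
    by (rule inverse_constant_unit[OF assms(1)])
  also have "poly Q ((x - m) / h) = poly P x" using assms(2) by (simp add: Q)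
  also have "integral {-r..r} (\<lambda>t. (poly Q t)\<^sup>2)
      = 1 / h * integral {m - r * h..m + r * h} (\<lambda>t. (poly P t)\<^sup>2)"
  proof -
    have "((\<lambda>t. (poly P t)\<^sup>2) has_integral integral {m - r * h..m + r * h} (\<lambda>t. (poly P t)\<^sup>2))
        (cbox (m - r * h) (m + r * h))"
      using poly_sq_integrable[of P "m - r * h" "m + r * h"] by (simp add: integrable_integral)
    from has_integral_affinity'[OF this assms(2), of m]
    have "((\<lambda>t. (poly P (m + h * t))\<^sup>2) has_integral
        (integral {m - r * h..m + r * h} (\<lambda>t. (poly P t)\<^sup>2) / h)) {-r..r}"
      using assms(2) by (simp add: add.commute field_simps)
    then show ?thesis by (simp add: Q integral_unique)
  qed
  finally show ?thesis by simp
qed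

text \<open>A polynomial of total degree at most \<open>p\<close> and its partial derivatives are of this kind, and the
  one-dimensional inequality can be applied to such functions one coordinate at a time.\<close>

definition slice_poly :: "nat \<Rightarrow> (point \<Rightarrow> real) \<Rightarrow> bool" where
  "slice_poly p G \<longleftrightarrow> continuous_on UNIV G
     \<and> (\<forall>y. \<exists>P. degree P \<le> p \<and> (\<forall>x. G (x, y) = poly P x))
     \<and> (\<forall>x. \<exists>P. degree P \<le> p \<and> (\<forall>y. G (x, y) = poly P y))"

lemma slice_poly_continuous: "slice_poly p G \<Longrightarrow> continuous_on S G"
  unfolding slice_poly_def by (meson continuous_on_subset subset_UNIV)

lemma slice_poly_add:
  assumes "slice_poly p F" "slice_poly p G" shows "slice_poly p (\<lambda>z. F z + G z)"
proof -
  have "\<exists>R. degree R \<le> p \<and> (\<forall>t. f t + g t = poly R t)"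
    if "\<exists>P. degree P \<le> p \<and> (\<forall>t. f t = poly P t)" "\<exists>P. degree P \<le> p \<and> (\<forall>t. g t = poly P t)"
    for f g :: "real \<Rightarrow> real"
    using that by (metis degree_add_le poly_add)
  then show ?thesis using assms unfolding slice_poly_def by (auto intro!: continuous_on_add)
qed

lemma slice_poly_cmult:
  assumes "slice_poly p G" shows "slice_poly p (\<lambda>z. k * G z)"
proof -
  have "\<exists>R. degree R \<le> p \<and> (\<forall>t. k * g t = poly R t)"
    if "\<exists>P. degree P \<le> p \<and> (\<forall>t. g t = poly P t)"
    for g :: "real \<Rightarrow> real"
    using that by (metis degree_smult_le order_trans poly_smult)
  then show ?thesis using assms unfolding slice_poly_def by (auto intro!: continuous_on_mult)
qed

lemma slice_poly_0: "slice_poly p (\<lambda>z. 0)"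
  unfolding slice_poly_def by (auto intro!: exI[of _ 0])

lemma slice_poly_sum:
  assumes "\<And>i. i \<in> I \<Longrightarrow> slice_poly p (F i)" shows "slice_poly p (\<lambda>z. \<Sum>i\<in>I. F i z)"
  using assms by (induction I rule: infinite_finite_induct) (auto intro: slice_poly_0 slice_poly_add)

lemma slice_poly_monomial:
  assumes "i \<le> p" "j \<le> p" shows "slice_poly p (\<lambda>z. fst z ^ i * snd z ^ j)"
proof -
  have "\<exists>P. degree P \<le> p \<and> (\<forall>t. t ^ n * k = poly P t)" if "n \<le> p" for n and k :: real
    using that by (intro exI[of _ "monom k n"])
      (auto simp: poly_monom mult.commute intro: order_trans[OF degree_monom_le])
  note this[OF assms(1)] this[OF assms(2)]
  then show ?thesis unfolding slice_poly_def
    by (auto intro!: continuous_intros simp: mult.commute)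
qed

text \<open>The one-dimensional inequality is applied first along the vertical and then along the horizontal
  direction. The point \<open>w\<close> may lie outside the square of integration, as long as it is within distance \<open>h\<close> of
  the centre; hence a triangle will enter only through a disc inside it and its diameter.\<close>

lemma inverse_inequality_2d:
  fixes h :: real
  assumes G: "slice_poly p G" and r: "r > 0" and h: "h > 0"
    and w: "\<bar>fst w - fst z\<bar> \<le> h" "\<bar>snd w - snd z\<bar> \<le> h"
  shows "(G w)\<^sup>2 \<le> (inverse_constant p r / h)\<^sup>2 *
    integral (cbox (fst z - r * h, snd z - r * h) (fst z + r * h, snd z + r * h)) (\<lambda>x. (G x)\<^sup>2)"
proof -
  define C where "C = inverse_constant p r / h"
  have C: "C \<ge> 0" using inverse_constant_pos[OF r] h by (simp add: C_def less_imp_le)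
  define l1 u1 l2 u2 where "l1 = fst z - r * h" and "u1 = fst z + r * h"
    and "l2 = snd z - r * h" and "u2 = snd z + r * h"
  obtain x y where xy: "w = (x, y)" by (cases w)
  have cont: "continuous_on S (\<lambda>z. (G z)\<^sup>2)" for S
    by (intro continuous_intros slice_poly_continuous[OF G])
  have 1: "(G (s, y))\<^sup>2 \<le> C * integral {l2..u2} (\<lambda>t. (G (s, t))\<^sup>2)" for s
  proof -
    obtain P where "degree P \<le> p" "\<And>t. G (s, t) = poly P t"
      using G unfolding slice_poly_def by blast
    then show ?thesis
      using inverse_inequality_1d[OF r h, of P p y "snd z"] w xy by (simp add: C_def l2_def u2_def)
  qed
  have 2: "(G (x, y))\<^sup>2 \<le> C * integral {l1..u1} (\<lambda>s. (G (s, y))\<^sup>2)"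
  proof -
    obtain P where "degree P \<le> p" "\<And>t. G (t, y) = poly P t"
      using G unfolding slice_poly_def by blast
    then show ?thesis
      using inverse_inequality_1d[OF r h, of P p x "fst z"] w xy by (simp add: C_def l1_def u1_def)
  qed
  have cont_inner: "continuous_on {l1..u1} (\<lambda>s. integral {l2..u2} (\<lambda>t. (G (s, t))\<^sup>2))"
  proof -
    have "continuous_on (cbox (l1, l2) (u1, u2)) (\<lambda>(s, t). (G (s, t))\<^sup>2)"
      using cont by (simp add: case_prod_unfold)
    then have "continuous_on (cbox l1 u1) (\<lambda>s. integral (cbox l2 u2) (\<lambda>t. (G (s, t))\<^sup>2))"
      by (intro integral_continuous_on_param) (simp add: cbox_Pair_eq)
    then show ?thesis by simp
  qed
  have "integral {l1..u1} (\<lambda>s. (G (s, y))\<^sup>2)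
      \<le> integral {l1..u1} (\<lambda>s. C * integral {l2..u2} (\<lambda>t. (G (s, t))\<^sup>2))"
  proof (intro integral_le 1 integrable_continuous_interval)
    show "continuous_on {l1..u1} (\<lambda>s. (G (s, y))\<^sup>2)"
      by (intro continuous_intros continuous_on_compose2[OF slice_poly_continuous[OF G, of UNIV]]) auto
    show "continuous_on {l1..u1} (\<lambda>s. C * integral {l2..u2} (\<lambda>t. (G (s, t))\<^sup>2))"
      using cont_inner by (intro continuous_intros)
  qed
  also have "\<dots> = C * integral (cbox (l1, l2) (u1, u2)) (\<lambda>x. (G x)\<^sup>2)"
    using integral_integrable_2dim[OF cont] integral_prod_continuous[OF cont, of l1 l2 u1 u2] by simp
  finally have "C * integral {l1..u1} (\<lambda>s. (G (s, y))\<^sup>2)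
      \<le> C * (C * integral (cbox (l1, l2) (u1, u2)) (\<lambda>x. (G x)\<^sup>2))"
    using C by (rule mult_left_mono)
  with 2 show ?thesis unfolding C_def l1_def l2_def u1_def u2_def xy by (simp add: power2_eq_square mult.assoc)
qed

text \<open>The partial derivatives are again combinations of monomials with both exponents at most \<open>p\<close>; for
  exponent \<open>0\<close> the truncated subtraction is harmless because the coefficient vanishes.\<close>

lemma Poly2_has_gradient:
  assumes "q \<in> Poly2 p"
  obtains g1 g2 where "slice_poly p q" "slice_poly p g1" "slice_poly p g2"
    "\<And>z. (q has_derivative (\<lambda>w. fst w * g1 z + snd w * g2 z)) (at z)"
proof -
  obtain k where q: "q = (\<lambda>(x, y). \<Sum>(i, j) \<in> {(i, j). i + j \<le> p}. k i j * x ^ i * y ^ j)"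
    using assms by (auto simp: Poly2_def)
  define I where "I = {(i, j). i + j \<le> p}"
  have fin: "finite I"
    by (rule finite_subset[of _ "{..p} \<times> {..p}"]) (auto simp: I_def)
  have q': "q = (\<lambda>z. \<Sum>i\<in>I. k (fst i) (snd i) * (fst z ^ fst i * snd z ^ snd i))"
    by (auto simp: q I_def case_prod_unfold mult.assoc fun_eq_iff)
  define g1 g2 where
    "g1 = (\<lambda>z::point. \<Sum>i\<in>I. (k (fst i) (snd i) * real (fst i)) * (fst z ^ (fst i - 1) * snd z ^ snd i))"
    and "g2 = (\<lambda>z::point. \<Sum>i\<in>I. (k (fst i) (snd i) * real (snd i)) * (fst z ^ fst i * snd z ^ (snd i - 1)))"
  have le: "fst i \<le> p" "snd i \<le> p" if "i \<in> I" for i using that by (auto simp: I_def)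
  show thesis
  proof
    show "slice_poly p q" unfolding q'
      by (intro slice_poly_sum slice_poly_cmult slice_poly_monomial le)
    show "slice_poly p g1" unfolding g1_def
      by (intro slice_poly_sum slice_poly_cmult slice_poly_monomial) (auto dest: le simp: le_diff_conv le_SucI)
    show "slice_poly p g2" unfolding g2_def
      by (intro slice_poly_sum slice_poly_cmult slice_poly_monomial) (auto dest: le simp: le_diff_conv le_SucI)
    fix z :: point
    show "(q has_derivative (\<lambda>w. fst w * g1 z + snd w * g2 z)) (at z)"
      unfolding q' g1_def g2_def
      by (auto intro!: derivative_eq_intros
          simp: fun_eq_iff sum_distrib_left sum.distrib[symmetric] algebra_simps intro!: sum.cong)
  qed
qed

section \<open>Traces, gradients and integrals over segments\<close>

lemma at_within_interior_neq_bot: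
  fixes T :: "'a::euclidean_space set"
  assumes "convex T" "closed T" "interior T \<noteq> {}" "z \<in> T"
  shows "at z within interior T \<noteq> bot"
proof -
  have "z \<in> closure (interior T)"
    using assms convex_closure_interior[of T] by simp
  moreover have "z islimpt interior T" if "z \<in> interior T"
    using that by (simp add: open_imp_islimpt)
  ultimately show ?thesis
    by (auto simp: trivial_limit_within closure_def)
qed

text \<open>The trace is a limit from the interior, and every point of a closed convex set with nonempty interior
  is a limit of interior points.\<close>

lemma tr_eq:
  assumes "convex T" "closed T" "interior T \<noteq> {}" "z \<in> T"
    and eq: "\<And>x. x \<in> interior T \<Longrightarrow> F x = G x" and cont: "isCont G z"
  shows "tr F T z = G z"
proof -
  have "(G \<longlongrightarrow> G z) (at z within interior T)"
    using cont continuous_at_imp_continuous_at_within continuous_within by blast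
  then have "(F \<longlongrightarrow> G z) (at z within interior T)"
    by (rule Lim_transform_eventually) (auto simp: eventually_at_filter eq)
  then show ?thesis
    unfolding tr_def using at_within_interior_neq_bot[OF assms(1-4)] by (intro tendsto_Lim)
qed

lemma grad_eq:
  assumes "open S" "z \<in> S" "\<And>x. x \<in> S \<Longrightarrow> v x = q x"
    and "(q has_derivative (\<lambda>w. fst w * g1 + snd w * g2)) (at z)"
  shows "grad v z = (g1, g2)"
proof -
  have "(v has_derivative (\<lambda>w. fst w * g1 + snd w * g2)) (at z)"
    using assms(4,1,2) by (rule has_derivative_transform_within_open) (simp add: assms(3))
  then have "frechet_derivative v (at z) = (\<lambda>w. fst w * g1 + snd w * g2)"
    by (metis frechet_derivative_at)
  moreover have B: "(Basis :: point set) = {(1, 0), (0, 1)}"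
    by (auto simp: Basis_prod_def)
  ultimately show ?thesis
    unfolding grad_def B by simp
qed

text \<open>The polynomial \<open>q\<close> and its partial derivatives \<open>g1\<close>, \<open>g2\<close> represent \<open>v\<close> and its gradient on \<open>T\<close>,
  inside as well as in the sense of traces.\<close>

definition element_poly ::
  "nat \<Rightarrow> (point \<Rightarrow> real) \<Rightarrow> point set \<Rightarrow> (point \<Rightarrow> real) \<Rightarrow> (point \<Rightarrow> real) \<Rightarrow> (point \<Rightarrow> real) \<Rightarrow> bool" where
  "element_poly p v T q g1 g2 \<longleftrightarrow> slice_poly p q \<and> slice_poly p g1 \<and> slice_poly p g2
     \<and> (\<forall>x\<in>interior T. v x = q x \<and> grad v x = (g1 x, g2 x))
     \<and> (\<forall>x\<in>T. tr v T x = q x \<and> tr (grad v) T x = (g1 x, g2 x))"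

lemma
  assumes "element_poly p v T q g1 g2"
  shows element_poly_slice: "slice_poly p q" "slice_poly p g1" "slice_poly p g2"
    and element_poly_interior: "x \<in> interior T \<Longrightarrow> v x = q x" "x \<in> interior T \<Longrightarrow> grad v x = (g1 x, g2 x)"
    and element_poly_tr: "x \<in> T \<Longrightarrow> tr v T x = q x" "x \<in> T \<Longrightarrow> tr (grad v) T x = (g1 x, g2 x)"
  using assms unfolding element_poly_def by blast+

lemma element_poly_exists:
  assumes T: "convex T" "closed T" "interior T \<noteq> {}"
    and q: "q \<in> Poly2 p" "\<And>x. x \<in> interior T \<Longrightarrow> v x = q x"
  obtains g1 g2 where "element_poly p v T q g1 g2"
proof -
  obtain g1 g2 where s: "slice_poly p q" "slice_poly p g1" "slice_poly p g2"
    and d: "\<And>z. (q has_derivative (\<lambda>w. fst w * g1 z + snd w * g2 z)) (at z)"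
    using Poly2_has_gradient[OF q(1)] by blast
  have c: "isCont q x" "isCont g1 x" "isCont g2 x" for x
    using s[THEN slice_poly_continuous[of p _ UNIV]]
    by (simp_all only: continuous_on_eq_continuous_at[OF open_UNIV] UNIV_I)
  have gr: "grad v x = (g1 x, g2 x)" if "x \<in> interior T" for x
    by (rule grad_eq[OF open_interior that q(2) d])
  have "tr v T x = q x" if "x \<in> T" for x
    by (rule tr_eq[OF T that q(2) c(1)])
  moreover have "tr (grad v) T x = (g1 x, g2 x)" if "x \<in> T" for x
    by (rule tr_eq[OF T that gr]) (assumption | rule continuous_Pair c)+
  ultimately have "element_poly p v T q g1 g2"
    unfolding element_poly_def using s q(2) gr by blast
  then show thesis by (rule that)
qed

lemma integrable_on_interior_compact:
  fixes f :: "'a::euclidean_space \<Rightarrow> real"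
  assumes "compact T" "continuous_on T f"
  shows "integrable (lebesgue_on (interior T)) f"
proof -
  have "set_integrable lborel T f"
    using borel_integrable_compact[OF assms] by (simp add: set_integrable_def)
  then have "set_integrable lborel (interior T) f"
    by (rule set_integrable_subset) (auto simp: interior_subset)
  then have "set_integrable lebesgue (interior T) f"
    unfolding set_integrable_def by (rule integrable_completion[THEN iffD2, rotated])
      (use \<open>set_integrable lborel (interior T) f\<close> in \<open>auto simp: set_integrable_def\<close>)
  then show ?thesis
    by (simp add: set_integrable_def integrable_restrict_space)
qed

text \<open>An inverse trace inequality in pointwise form. A square of half side \<open>\<rho> h / 2\<close> fits into the inscribed
  disc, and \<open>T\<close> itself lies within distance \<open>h\<close> of its centre, so the two-dimensional inverse inequality
  applies to both components of the gradient.\<close>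

lemma element_gradient_bound:
  fixes h :: real
  assumes T: "convex T" "compact T" "ball z (\<rho> * h) \<subseteq> T" "diameter T \<le> h" and pos: "\<rho> > 0" "h > 0"
    and q: "q \<in> Poly2 p" "\<And>x. x \<in> interior T \<Longrightarrow> v x = q x" and w: "w \<in> T"
  shows "(norm (tr (grad v) T w))\<^sup>2 \<le> (inverse_constant p (\<rho> / 2) / h)\<^sup>2
    * (LINT x|lebesgue_on (interior T). (norm (grad v x))\<^sup>2)"
proof -
  define B where "B = cbox (fst z - \<rho> / 2 * h, snd z - \<rho> / 2 * h) (fst z + \<rho> / 2 * h, snd z + \<rho> / 2 * h)"
  define K where "K = (inverse_constant p (\<rho> / 2) / h)\<^sup>2"
  have z: "z \<in> T" "z \<in> interior T"
    using pos by (auto intro: subsetD[OF T(3)] subsetD[OF interior_maximal[OF T(3) open_ball]])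
  have ne: "interior T \<noteq> {}" using z(2) by blast
  obtain g1 g2 where ep: "element_poly p v T q g1 g2"
    using element_poly_exists[OF T(1) compact_imp_closed[OF T(2)] ne q] by blast
  note g = element_poly_slice(2,3)[OF ep] element_poly_interior(2)[OF ep] element_poly_tr(2)[OF ep]
  note cont = slice_poly_continuous[OF g(1)] slice_poly_continuous[OF g(2)]
  have dist: "dist w z \<le> h"
    using diameter_bounded_bound[OF compact_imp_bounded[OF T(2)] w z(1)] T(4) by linarith
  then have w1: "\<bar>fst w - fst z\<bar> \<le> h" "\<bar>snd w - snd z\<bar> \<le> h"
    using dist_fst_le[of w z] dist_snd_le[of w z] by (auto simp: dist_real_def)
  have B: "B \<subseteq> interior T"
  proof -
    have "x \<in> ball z (\<rho> * h)" if "x \<in> B" for x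
    proof -
      have "\<bar>fst x - fst z\<bar> \<le> \<rho> * h / 2" "\<bar>snd x - snd z\<bar> \<le> \<rho> * h / 2"
        using that unfolding abs_le_iff by (simp_all add: B_def cbox_Pair_eq mem_Times_iff)
      then have "(fst x - fst z)\<^sup>2 \<le> (\<rho> * h / 2)\<^sup>2" "(snd x - snd z)\<^sup>2 \<le> (\<rho> * h / 2)\<^sup>2"
        by (metis abs_ge_zero power2_abs power_mono)+
      moreover have "(dist x z)\<^sup>2 = (fst x - fst z)\<^sup>2 + (snd x - snd z)\<^sup>2"
        by (cases x; cases z) (simp add: dist_Pair_Pair dist_real_def)
      ultimately have "(dist x z)\<^sup>2 \<le> (\<rho> * h / 2)\<^sup>2 + (\<rho> * h / 2)\<^sup>2" by (metis add_mono)
      also have "\<dots> < (\<rho> * h)\<^sup>2" using pos by (simp add: power_divide)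
      finally have "(dist x z)\<^sup>2 < (\<rho> * h)\<^sup>2" .
      then show ?thesis using pos by (simp add: dist_commute power_less_imp_less_base)
    qed
    then have "B \<subseteq> ball z (\<rho> * h)" by blast
    then show ?thesis using interior_maximal[OF T(3) open_ball] by (rule order_trans)
  qed
  have int: "integral B (\<lambda>x. (g1 x)\<^sup>2 + (g2 x)\<^sup>2)
      \<le> (LINT x|lebesgue_on (interior T). (norm (grad v x))\<^sup>2)"
  proof -
    have "integrable (lebesgue_on (interior T)) (\<lambda>x. (g1 x)\<^sup>2 + (g2 x)\<^sup>2)"
      by (intro integrable_on_interior_compact T continuous_intros cont)
    then have "integral (interior T) (\<lambda>x. (g1 x)\<^sup>2 + (g2 x)\<^sup>2)
        = (LINT x|lebesgue_on (interior T). (g1 x)\<^sup>2 + (g2 x)\<^sup>2)"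
      and "(\<lambda>x. (g1 x)\<^sup>2 + (g2 x)\<^sup>2) integrable_on interior T"
      by (simp_all add: lebesgue_integral_eq_integral integrable_on_lebesgue_on)
    moreover have "(LINT x|lebesgue_on (interior T). (g1 x)\<^sup>2 + (g2 x)\<^sup>2)
        = (LINT x|lebesgue_on (interior T). (norm (grad v x))\<^sup>2)"
      by (rule Bochner_Integration.integral_cong)
        (simp_all add: g(3) norm_Pair)
    moreover have "integral B (\<lambda>x. (g1 x)\<^sup>2 + (g2 x)\<^sup>2) \<le> integral (interior T) (\<lambda>x. (g1 x)\<^sup>2 + (g2 x)\<^sup>2)"
    proof (rule integral_subset_le[OF B _ calculation(2)])
      show "(\<lambda>x. (g1 x)\<^sup>2 + (g2 x)\<^sup>2) integrable_on B"
        unfolding B_def by (intro integrable_continuous continuous_intros cont)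
    qed simp
    ultimately show ?thesis by simp
  qed
  have "(norm (tr (grad v) T w))\<^sup>2 = (g1 w)\<^sup>2 + (g2 w)\<^sup>2"
    by (simp add: g(4) w norm_Pair)
  also have "\<dots> \<le> K * integral B (\<lambda>x. (g1 x)\<^sup>2) + K * integral B (\<lambda>x. (g2 x)\<^sup>2)"
    unfolding K_def B_def using pos w1
    by (intro add_mono inverse_inequality_2d g) simp_all
  also have "\<dots> = K * integral B (\<lambda>x. (g1 x)\<^sup>2 + (g2 x)\<^sup>2)"
    unfolding B_def
    by (subst integral_add) (intro integrable_continuous continuous_intros cont | simp add: distrib_left)+
  also have "\<dots> \<le> K * (LINT x|lebesgue_on (interior T). (norm (grad v x))\<^sup>2)"
    using int by (rule mult_left_mono) (simp add: K_def)
  finally show ?thesis by (simp add: K_def)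
qed

definition is_segment :: "point set \<Rightarrow> bool" where
  "is_segment e \<longleftrightarrow> (\<exists>P Q. e = closed_segment P Q)"

lemma seg_int_cong:
  assumes "is_segment e" "\<And>x. x \<in> e \<Longrightarrow> \<phi> x = \<psi> x" shows "seg_int e \<phi> = seg_int e \<psi>"
proof -
  obtain P Q where e: "e = closed_segment P Q" using assms(1) by (auto simp: is_segment_def)
  have "\<phi> (linepath P Q s) = \<psi> (linepath P Q s)" if "s \<in> {0..1}" for s
    using assms(2) that linepath_in_path[of s P Q] by (simp add: e)
  then have "(LINT s|lebesgue_on {0..1}. \<phi> (linepath P Q s)) = (LINT s|lebesgue_on {0..1}. \<psi> (linepath P Q s))"
    by (intro Bochner_Integration.integral_cong) auto
  then show ?thesis by (simp add: e seg_int_closed_segment)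
qed

lemma integrable_linepath:
  assumes "continuous_on (closed_segment P Q) \<phi>"
  shows "integrable (lebesgue_on {0..1}) (\<lambda>s. \<phi> (linepath P Q s) :: real)"
  by (intro continuous_imp_integrable_real continuous_on_compose2[OF assms] continuous_on_linepath)
    (auto simp: linepath_in_path)

lemma seg_int_mono:
  assumes "is_segment e" "continuous_on e \<phi>" "continuous_on e \<psi>" "\<And>x. x \<in> e \<Longrightarrow> \<phi> x \<le> \<psi> x"
  shows "seg_int e \<phi> \<le> seg_int e \<psi>"
proof -
  obtain P Q where e: "e = closed_segment P Q" using assms(1) by (auto simp: is_segment_def)
  have "(LINT s|lebesgue_on {0..1}. \<phi> (linepath P Q s)) \<le> (LINT s|lebesgue_on {0..1}. \<psi> (linepath P Q s))"
    using assms linepath_in_path[of _ P Q] unfolding e by (intro integral_mono integrable_linepath) auto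
  then show ?thesis by (simp add: e seg_int_closed_segment mult_left_mono)
qed

lemma seg_int_nonneg:
  assumes "is_segment e" "\<And>x. x \<in> e \<Longrightarrow> \<phi> x \<ge> 0" shows "seg_int e \<phi> \<ge> 0"
proof -
  obtain P Q where e: "e = closed_segment P Q" using assms(1) by (auto simp: is_segment_def)
  have "(LINT s|lebesgue_on {0..1}. \<phi> (linepath P Q s)) \<ge> 0"
    using assms linepath_in_path[of _ P Q] unfolding e by (intro integral_nonneg_AE AE_I2) auto
  then show ?thesis by (simp add: e seg_int_closed_segment)
qed

lemma seg_int_lincomb:
  assumes "is_segment e" "continuous_on e \<phi>" "continuous_on e \<psi>"
  shows "seg_int e (\<lambda>x. k * \<phi> x + l * \<psi> x) = k * seg_int e \<phi> + l * seg_int e \<psi>"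
proof -
  obtain P Q where e: "e = closed_segment P Q" using assms(1) by (auto simp: is_segment_def)
  have "(LINT s|lebesgue_on {0..1}. k * \<phi> (linepath P Q s) + l * \<psi> (linepath P Q s))
      = k * (LINT s|lebesgue_on {0..1}. \<phi> (linepath P Q s)) + l * (LINT s|lebesgue_on {0..1}. \<psi> (linepath P Q s))"
    using integrable_linepath[OF assms(2)[unfolded e]] integrable_linepath[OF assms(3)[unfolded e]] by simp
  then show ?thesis by (simp add: e seg_int_closed_segment algebra_simps)
qed

text \<open>Bounding an edge integral by length times maximum loses nothing in the order of \<open>h\<close> here, since the
  pointwise bounds are already uniform on the element.\<close>

lemma seg_int_le_diameter:
  assumes "is_segment e" "continuous_on e \<phi>" "\<And>x. x \<in> e \<Longrightarrow> \<phi> x \<le> M" "0 \<le> M"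
    "\<And>x y. x \<in> e \<Longrightarrow> y \<in> e \<Longrightarrow> dist x y \<le> h"
  shows "seg_int e \<phi> \<le> h * M"
proof -
  obtain P Q where e: "e = closed_segment P Q" using assms(1) by (auto simp: is_segment_def)
  have "seg_int e \<phi> \<le> seg_int e (\<lambda>_. M)"
    using assms by (intro seg_int_mono) auto
  also have "\<dots> = dist P Q * M" by (simp add: e seg_int_closed_segment measure_restrict_space)
  also have "\<dots> \<le> h * M" using assms by (intro mult_right_mono) (auto simp: e)
  finally show ?thesis .
qed

text \<open>Along a horizontal segment \<open>G\<close> is a polynomial in the parameter of \<open>linepath\<close>. Edges on the top and bottom
  of the rectangle are horizontal, so this covers all ridges.\<close>

lemma horizontal_segment_inverse_inequality:
  assumes G: "slice_poly p G" and e: "e = closed_segment (x1, y) (x2, y)" and x: "x \<in> e"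
  shows "\<bar>x2 - x1\<bar> * (G x)\<^sup>2 \<le> 2 * inverse_constant p 1 * seg_int e (\<lambda>x. (G x)\<^sup>2)"
proof -
  obtain P where P: "degree P \<le> p" "\<And>t. G (t, y) = poly P t"
    using G unfolding slice_poly_def by blast
  define Q where "Q = pcompose P [:x1, x2 - x1:]"
  have lp: "linepath (x1, y) (x2, y) s = (x1 + s * (x2 - x1), y)" for s
    by (simp add: linepath_def algebra_simps)
  have Q: "poly Q s = G (linepath (x1, y) (x2, y) s)" for s
    by (simp add: Q_def poly_pcompose lp P)
  have "degree Q \<le> p"
    unfolding Q_def degree_pcompose using P(1) by (cases "x2 = x1") auto
  obtain s where s: "s \<in> {0..1}" "x = linepath (x1, y) (x2, y) s"
    using x unfolding e by (metis path_image_linepath path_image_def imageE)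
  have "(poly Q s)\<^sup>2 \<le> inverse_constant p 1 / (1/2) * integral {1/2 - 1 * (1/2)..1/2 + 1 * (1/2)} (\<lambda>t. (poly Q t)\<^sup>2)"
    using s \<open>degree Q \<le> p\<close> by (intro inverse_inequality_1d) (auto simp: abs_if)
  also have "\<dots> = 2 * inverse_constant p 1 * integral {0..1} (\<lambda>t. (poly Q t)\<^sup>2)" by simp
  also have "integral {0..1} (\<lambda>t. (poly Q t)\<^sup>2) = (LINT t|lebesgue_on {0..1}. (poly Q t)\<^sup>2)"
    by (intro lebesgue_integral_eq_integral[symmetric] continuous_imp_integrable_real continuous_on_poly_sq) auto
  finally have "(G x)\<^sup>2 \<le> 2 * inverse_constant p 1 * (LINT t|lebesgue_on {0..1}. (G (linepath (x1, y) (x2, y) t))\<^sup>2)"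
    using s by (simp add: Q)
  then have "\<bar>x2 - x1\<bar> * (G x)\<^sup>2 \<le> \<bar>x2 - x1\<bar> * (2 * inverse_constant p 1 * (LINT t|lebesgue_on {0..1}. (G (linepath (x1, y) (x2, y) t))\<^sup>2))"
    by (rule mult_left_mono) simp
  also have "\<dots> = 2 * inverse_constant p 1 * seg_int e (\<lambda>x. (G x)\<^sup>2)"
    by (simp add: e seg_int_closed_segment dist_Pair_Pair dist_real_def abs_minus_commute)
  finally show ?thesis .
qed

section \<open>Triangles and quasi-uniform meshes\<close>

lemma two_simplexE:
  fixes T :: "point set"
  assumes "2 simplex T"
  obtains A B C where "A \<noteq> B" "A \<noteq> C" "B \<noteq> C" "\<not> affine_dependent {A, B, C}" "T = convex hull {A, B, C}"
proof -
  obtain V where V: "\<not> affine_dependent V" "int (card V) = 2 + 1" "T = convex hull V"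
    using assms unfolding simplex_def by blast
  then have "card V = 3" by simp
  then obtain A B C where "V = {A, B, C}" "A \<noteq> B" "A \<noteq> C" "B \<noteq> C"
    unfolding card_3_iff by blast
  then show thesis using V that by blast
qed

lemma two_simplex_compact_convex:
  fixes T :: "point set"
  assumes "2 simplex T"
  shows "compact T" "convex T" "interior T \<noteq> {}"
proof -
  show "compact T" "convex T"
    using simplex_imp_polytope[OF assms] polytope_imp_compact polytope_imp_convex by blast+
  have "aff_dim T = 2" using aff_dim_simplex[OF assms] .
  then have "affine hull T = UNIV" using aff_dim_eq_full[of T] by simp
  then have "interior T = rel_interior T" by (simp add: rel_interior_interior)
  moreover have "T \<noteq> {}" using \<open>aff_dim T = 2\<close> by auto
  ultimately show "interior T \<noteq> {}"
    using \<open>convex T\<close> rel_interior_eq_empty by blast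
qed

text \<open>Every face of a triangle is the convex hull of some of its vertices.\<close>

lemma
  fixes T :: "point set"
  assumes "2 simplex T"
  shows finite_edges_of_simplex: "finite {e. e edge_of T}"
    and card_edges_of_simplex: "card {e. e edge_of T} \<le> 8"
proof -
  obtain A B C where T: "T = convex hull {A, B, C}" and ne: "A \<noteq> B" "A \<noteq> C" "B \<noteq> C"
    using two_simplexE[OF assms] by metis
  have "e \<in> (hull) convex ` Pow {A, B, C}" if e: "e edge_of T" for e
  proof -
    have "e face_of convex hull {A, B, C}" using e by (simp add: edge_of_def T)
    then obtain S' where "S' \<subseteq> {A, B, C}" "e = convex hull S'"
      by (rule face_of_convex_hull_subset[rotated]) (simp_all add: finite_imp_compact)
    then show ?thesis by (intro image_eqI[of _ _ S']) (auto simp only: Pow_iff)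
  qed
  then have sub: "{e. e edge_of T} \<subseteq> (hull) convex ` Pow {A, B, C}" by (intro subsetI) (simp only: mem_Collect_eq)
  have fin: "finite ((hull) convex ` Pow {A, B, C})" by simp
  show "finite {e. e edge_of T}" using finite_subset[OF sub fin] .
  have "card {e. e edge_of T} \<le> card ((hull) convex ` Pow {A, B, C})" by (rule card_mono[OF fin sub])
  also have "\<dots> \<le> card (Pow {A, B, C})" by (rule card_image_le) simp
  also have "\<dots> = 8" using ne by (simp add: card_Pow)
  finally show "card {e. e edge_of T} \<le> 8" .
qed

lemma edge_is_segment:
  fixes T :: "point set"
  assumes "e edge_of T" "compact T" "convex T"
  obtains P Q where "e = closed_segment P Q" "P \<noteq> Q"
proof -
  have face: "e face_of T" and dim: "aff_dim e = 1" using assms(1) by (auto simp: edge_of_def)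
  have "compact e" "convex e" using face_of_imp_compact[OF assms(3,2) face] face_of_imp_convex[OF face] .
  moreover have "e \<noteq> {}" "collinear e" using dim by (auto simp: collinear_aff_dim)
  ultimately obtain P Q where e: "e = closed_segment P Q" using compact_convex_collinear_segment by metis
  moreover have "P \<noteq> Q" using dim e by (auto simp: aff_dim_sing)
  ultimately show thesis by (rule that)
qed

lemma edge_ends_extreme:
  fixes T :: "point set"
  assumes "closed_segment P Q edge_of T"
  shows "P extreme_point_of T" "Q extreme_point_of T"
  using assms extreme_point_of_face[of "closed_segment P Q" T] extreme_point_of_segment[of _ P Q]
  unfolding edge_of_def by blast+

text \<open>Project onto a normal of the line through one end \<open>P\<close> of the edge and the opposite vertex. The triangle
  projects onto an interval of length at most \<open>dist P Q\<close>, the disc onto one of length \<open>2 * r\<close>.\<close>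

lemma edge_length_ge:
  fixes T :: "point set"
  assumes T: "2 simplex T" and e: "closed_segment P Q edge_of T" and ball: "ball z r \<subseteq> T"
  shows "2 * r \<le> dist P Q"
proof -
  obtain A B C where ABC: "\<not> affine_dependent {A, B, C}" "T = convex hull {A, B, C}"
    using two_simplexE[OF T] by metis
  have "P \<noteq> Q" using e by (auto simp: edge_of_def aff_dim_sing)
  moreover have "P \<in> {A, B, C}" "Q \<in> {A, B, C}"
    using edge_ends_extreme[OF e] unfolding ABC(2) by (metis extreme_point_of_convex_hull)+
  ultimately obtain R where PQR: "{A, B, C} = {P, Q, R}" by blast
  \<comment> \<open>rotation of the side \<open>R - P\<close> by a right angle; if \<open>R = P\<close>, any nonzero vector is orthogonal to it\<close>
  define m :: point where "m = (if R = P then (1, 0) else (- snd (R - P), fst (R - P)))"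
  define n where "n = m /\<^sub>R norm m"
  have "m \<noteq> 0" by (cases P; cases R) (auto simp: m_def zero_prod_def)
  then have n: "norm n = 1" by (simp add: n_def)
  have "m \<bullet> (R - P) = 0" by (cases "R = P") (auto simp: m_def inner_prod_def algebra_simps)
  then have nR: "n \<bullet> R = n \<bullet> P" by (simp add: n_def inner_diff_right)
  define q where "q = n \<bullet> (Q - P)"
  have q: "\<bar>q\<bar> \<le> dist P Q"
    using Cauchy_Schwarz_ineq2[of n "Q - P"] n by (simp add: q_def dist_norm norm_minus_commute)
  have width: "\<exists>t\<in>{0..1}. n \<bullet> x = n \<bullet> P + t * q" if "x \<in> T" for x
  proof -
    obtain u v w where "u \<ge> 0" "v \<ge> 0" "w \<ge> 0" "u + v + w = 1" and x: "x = u *\<^sub>R P + v *\<^sub>R Q + w *\<^sub>R R"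
      using \<open>x \<in> T\<close> unfolding ABC(2) PQR convex_hull_3 by blast
    moreover from this have "u = 1 - v - w" by simp
    moreover have "n \<bullet> x = n \<bullet> P + v * q"
      unfolding x \<open>u = 1 - v - w\<close> by (simp add: inner_add_right inner_diff_right nR q_def algebra_simps)
    ultimately show ?thesis by (intro bexI[of _ v]) auto
  qed
  have le: "\<bar>n \<bullet> x - n \<bullet> y\<bar> \<le> \<bar>q\<bar>" if xy: "x \<in> T" "y \<in> T" for x y
  proof -
    obtain s t where st: "s \<in> {0..1}" "t \<in> {0..1}" "n \<bullet> x = n \<bullet> P + s * q" "n \<bullet> y = n \<bullet> P + t * q"
      using width[OF xy(1)] width[OF xy(2)] by blast
    then have "\<bar>n \<bullet> x - n \<bullet> y\<bar> = \<bar>s - t\<bar> * \<bar>q\<bar>"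
      unfolding abs_mult[symmetric] by (simp add: algebra_simps)
    also have "\<dots> \<le> 1 * \<bar>q\<bar>" using st(1,2) by (intro mult_right_mono) auto
    finally show ?thesis by simp
  qed
  have "2 * s \<le> dist P Q" if s: "0 < s" "s < r" for s
  proof -
    have "z + s *\<^sub>R n \<in> T" "z - s *\<^sub>R n \<in> T"
      using s n by (auto intro!: subsetD[OF ball] simp: dist_norm)
    from le[OF this] have "\<bar>2 * s * (n \<bullet> n)\<bar> \<le> \<bar>q\<bar>" by (simp add: inner_add_right inner_diff_right)
    then show ?thesis using s q n by (simp add: dot_square_norm)
  qed
  note small = this
  show ?thesis
  proof (rule ccontr)
    assume "\<not> ?thesis"
    then have "dist P Q / 2 < r" by simp
    then obtain s where "dist P Q / 2 < s" "s < r" using dense by blast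
    moreover from this have "0 < s" using zero_le_dist[of P Q] by linarith
    ultimately show False using small[of s] by simp
  qed
qed

text \<open>The affine form \<open>f\<close> vanishes on the line through the side \<open>A B\<close>, and \<open>z\<close> lies inside that side. Near
  \<open>z\<close> the barycentric coordinates of \<open>A\<close> and \<open>B\<close> stay positive, so membership in the triangle is decided
  by the sign of \<open>f\<close> alone. The functions \<open>r\<close> and \<open>t\<close> in the proof are the coordinates of \<open>B\<close> and \<open>C\<close>.\<close>

lemma half_ball_at_side_point:
  fixes A B C z :: point
  assumes T: "T = convex hull {A, B, C}" "interior T \<noteq> {}"
    and f: "\<And>w. f w = s * (snd w - y)" "s \<noteq> 0" "f A = 0" "f B = 0" "f C \<ge> 0"
    and z: "z = u *\<^sub>R A + v *\<^sub>R B + k *\<^sub>R C" "u > 0" "v > 0" "k \<ge> 0" "u + v + k = 1" "f z = 0"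
  shows "\<exists>\<epsilon>>0. \<forall>w. dist z w < \<epsilon> \<and> f w \<ge> 0 \<longrightarrow> w \<in> T"
proof -
  have yA: "snd A = y" and yB: "snd B = y" using f by auto
  have "f C \<noteq> 0"
  proof
    assume "f C = 0"
    then have "snd C = y" using f by auto
    then have "{A, B, C} \<subseteq> {w. (0, 1) \<bullet> w = y}" using yA yB by (auto simp: inner_prod_def)
    then have "T \<subseteq> {w. (0, 1) \<bullet> w = y}" unfolding T(1) by (intro hull_minimal convex_hyperplane)
    then have "interior T \<subseteq> interior {w. ((0, 1)::point) \<bullet> w = y}" by (rule interior_mono)
    then show False using T(2) by (simp add: interior_hyperplane zero_prod_def)
  qed
  then have fC: "f C > 0" using f(5) by linarith
  have "f z = u * f A + v * f B + k * f C"
  proof -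
    have u: "u = 1 - v - k" using z(5) by simp
    show ?thesis unfolding f(1) z(1) u by (simp add: algebra_simps)
  qed
  then have "k * f C = 0" using f(3,4) z(6) by simp
  then have k: "k = 0" using fC by simp
  then have uv: "u = 1 - v" "v < 1" using z by auto
  have "fst A \<noteq> fst B"
  proof
    assume "fst A = fst B"
    then have "A = B" using yA yB by (simp add: prod_eq_iff)
    then have "T = closed_segment A C" unfolding T(1) by (simp add: segment_convex_hull insert_commute)
    then have "collinear T" by simp
    then have "aff_dim T \<le> 1" by (simp add: collinear_aff_dim)
    moreover have "aff_dim T = 2" using aff_dim_nonempty_interior[OF T(2)] by simp
    ultimately show False by simp
  qed
  then have AB: "fst B - fst A \<noteq> 0" by simp
  define t where "t w = f w / f C" for w
  define r where "r w = (fst w - fst A - t w * (fst C - fst A)) / (fst B - fst A)" for w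
  have mem: "w \<in> T" if w: "f w \<ge> 0" "r w > 0" "r w + t w < 1" for w
  proof -
    have t: "t w \<ge> 0" using w(1) fC by (simp add: t_def)
    have "fst w = (1 - r w - t w) * fst A + r w * fst B + t w * fst C"
    proof -
      have "r w * (fst B - fst A) = fst w - fst A - t w * (fst C - fst A)" using AB by (simp add: r_def)
      then show ?thesis by (simp add: algebra_simps)
    qed
    moreover have "snd w = (1 - r w - t w) * snd A + r w * snd B + t w * snd C"
    proof -
      have "f w = t w * f C" using \<open>f C \<noteq> 0\<close> by (simp add: t_def)
      then have "s * (snd w - y) = t w * (s * (snd C - y))" unfolding f(1) .
      then have "s * (snd w - y) = s * (t w * (snd C - y))" by (simp only: mult.left_commute)
      then have "snd w - y = t w * (snd C - y)" using mult_left_cancel[OF f(2)] by blast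
      then show ?thesis by (simp add: yA yB algebra_simps)
    qed
    ultimately have "w = (1 - r w - t w) *\<^sub>R A + r w *\<^sub>R B + t w *\<^sub>R C" by (simp add: prod_eq_iff)
    then show ?thesis unfolding T(1) convex_hull_3 mem_Collect_eq
      using w t by (intro exI[of _ "1 - r w - t w"] exI[of _ "r w"] exI[of _ "t w"]) simp
  qed
  have tz: "t z = 0" using z by (simp add: t_def)
  have rz: "r z = v"
  proof -
    have "fst z - fst A = v * (fst B - fst A)" unfolding z(1) uv k by (simp add: algebra_simps)
    then show ?thesis using AB by (simp add: r_def tz)
  qed
  have "open {w. r w > 0 \<and> r w + t w < 1}"
    unfolding r_def t_def f(1) using AB fC unfolding f(1)
    by (intro open_Collect_conj open_Collect_less continuous_intros) auto
  moreover have "z \<in> {w. r w > 0 \<and> r w + t w < 1}" using tz rz uv z by simp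
  ultimately obtain \<epsilon> where "\<epsilon> > 0" "ball z \<epsilon> \<subseteq> {w. r w > 0 \<and> r w + t w < 1}" using openE by blast
  then show ?thesis using mem by (intro exI[of _ \<epsilon>]) (metis (mono_tags, lifting) mem_Collect_eq mem_ball subsetD)
qed

text \<open>If the triangle lies in the half plane \<open>f \<ge> 0\<close> and touches its boundary in a point that is not a vertex,
  then all vertices with positive weight lie on the boundary line, so that two of them span a side
  through \<open>z\<close>.\<close>

lemma half_ball:
  fixes T :: "point set"
  assumes T: "2 simplex T" and f: "\<And>w. f w = s * (snd w - y)" "s \<noteq> 0" "\<And>w. w \<in> T \<Longrightarrow> f w \<ge> 0"
    and z: "z \<in> T" "f z = 0" "\<not> z extreme_point_of T"
  shows "\<exists>\<epsilon>>0. \<forall>w. dist z w < \<epsilon> \<and> f w \<ge> 0 \<longrightarrow> w \<in> T"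
proof -
  obtain A B C where ABC: "\<not> affine_dependent {A, B, C}" "T = convex hull {A, B, C}"
    using two_simplexE[OF T] by metis
  have int: "interior T \<noteq> {}" using two_simplex_compact_convex[OF T] by simp
  have ext: "A extreme_point_of T" "B extreme_point_of T" "C extreme_point_of T"
    using extreme_point_of_convex_hull_affine_independent[OF ABC(1)] ABC(2) by auto
  then have pos: "f A \<ge> 0" "f B \<ge> 0" "f C \<ge> 0"
    using f(3) by (auto simp: extreme_point_of_def)
  obtain u v k where uvk: "u \<ge> 0" "v \<ge> 0" "k \<ge> 0" "u + v + k = 1" and zeq: "z = u *\<^sub>R A + v *\<^sub>R B + k *\<^sub>R C"
    using z(1) unfolding ABC(2) convex_hull_3 by blast
  have "f z = u * f A + v * f B + k * f C"
  proof -
    have u: "u = 1 - v - k" using uvk by simp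
    show ?thesis unfolding f(1) zeq u by (simp add: algebra_simps)
  qed
  then have "u * f A + v * f B + k * f C = 0" using z by simp
  moreover have "u * f A \<ge> 0" "v * f B \<ge> 0" "k * f C \<ge> 0" using uvk pos by simp_all
  ultimately have zero: "u * f A = 0" "v * f B = 0" "k * f C = 0" by linarith+
  have n1: "\<not> (v = 0 \<and> k = 0)" "\<not> (u = 0 \<and> k = 0)" "\<not> (u = 0 \<and> v = 0)"
    using z(3) ext uvk(4) zeq by auto
  consider "u > 0" "v > 0" | "u > 0" "k > 0" | "v > 0" "k > 0"
    using n1 uvk by linarith
  then show ?thesis
  proof cases
    case 1
    then show ?thesis using zero uvk pos z
      by (intro half_ball_at_side_point[OF ABC(2) int f(1,2) _ _ _ zeq]) simp_all
  next
    case 2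
    have "T = convex hull {A, C, B}" using ABC(2) by (simp add: insert_commute)
    moreover have "z = u *\<^sub>R A + k *\<^sub>R C + v *\<^sub>R B" using zeq by simp
    ultimately show ?thesis using zero uvk pos z 2 int
      by (intro half_ball_at_side_point[of T A C B f s y z u k v]) (simp_all add: f)
  next
    case 3
    have "T = convex hull {B, C, A}" using ABC(2) by (simp add: insert_commute)
    moreover have "z = v *\<^sub>R B + k *\<^sub>R C + u *\<^sub>R A" using zeq by simp
    ultimately show ?thesis using zero uvk pos z 3 int
      by (intro half_ball_at_side_point[of T B C A f s y z v k u]) (simp_all add: f)
  qed
qed


locale quasi_uniform_mesh = dg_setting +
  fixes \<rho> :: real
  assumes ab: "a < b" and cd: "c < d" and conforming: conforming_mesh
    and quasi_uniform: "quasi_uniform \<rho>" and \<rho>: "\<rho> > 0"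
begin

lemma finite_Th: "finite Th"
  and simplex: "T \<in> Th \<Longrightarrow> 2 simplex T"
  and Union_Th: "\<Union>Th = {a..b} \<times> {c..d}"
  and Int_face_of: "T \<in> Th \<Longrightarrow> T' \<in> Th \<Longrightarrow> (T \<inter> T') face_of T"
  using conforming unfolding conforming_mesh_def triangulation_def by simp_all

lemma
  assumes "T \<in> Th"
  shows compact_elem: "compact T" and convex_elem: "convex T" and interior_elem: "interior T \<noteq> {}"
    and closed_elem: "closed T"
  using two_simplex_compact_convex[OF simplex[OF assms]] by (simp_all add: compact_imp_closed)

lemma elem_subset: "T \<in> Th \<Longrightarrow> T \<subseteq> {a..b} \<times> {c..d}"
  using Union_Th Union_upper[of T Th] by simp

lemma Th_nonempty: "Th \<noteq> {}"
proof
  assume "Th = {}"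
  then have "{a..b} \<times> {c..d} = {}" using Union_Th by simp
  then show False using ab cd by simp
qed

lemma diameter_le_h: "T \<in> Th \<Longrightarrow> diameter T \<le> h"
  unfolding h_def using finite_Th by (intro Max_ge) auto

lemma dist_le_h: "T \<in> Th \<Longrightarrow> x \<in> T \<Longrightarrow> y \<in> T \<Longrightarrow> dist x y \<le> h"
  using diameter_bounded_bound[OF compact_imp_bounded[OF compact_elem]] diameter_le_h by (meson order_trans)

lemma h_pos: "h > 0"
proof -
  obtain T where T: "T \<in> Th" using Th_nonempty by blast
  obtain A B C where "A \<noteq> B" "T = convex hull {A, B, C}"
    using two_simplexE[OF simplex[OF T]] by metis
  then have "A \<in> T" "B \<in> T" by (auto simp: hull_inc)
  then have "dist A B \<le> h" using dist_le_h[OF T] by blast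
  moreover have "dist A B > 0" using \<open>A \<noteq> B\<close> by simp
  ultimately show ?thesis by linarith
qed

lemma elem_ball:
  assumes "T \<in> Th" obtains z where "ball z (\<rho> * h) \<subseteq> T"
  using bspec[OF quasi_uniform[unfolded quasi_uniform_def] assms] by (elim exE)

text \<open>A proper face of a convex set misses its interior; hence if \<open>T \<inter> T'\<close> meets the interior of \<open>T\<close>, it
  must be all of \<open>T\<close>, and symmetrically all of \<open>T'\<close>.\<close>

lemma interiors_disjoint:
  assumes "T \<in> Th" "T' \<in> Th" "x \<in> interior T" "x \<in> T'"
  shows "T = T'"
proof (rule ccontr)
  assume "T \<noteq> T'"
  have 1: "T \<inter> T' = T"
    using face_of_disjoint_interior[OF Int_face_of[OF assms(1,2)]] assms(3,4) interior_subset[of T] by blast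
  then have "x \<in> interior T'" using assms(3) interior_mono[of T T'] by blast
  then have "T' \<inter> T = T'"
    using face_of_disjoint_interior[OF Int_face_of[OF assms(2,1)]] assms interior_subset[of T] by blast
  with 1 \<open>T \<noteq> T'\<close> show False by blast
qed

text \<open>The inscribed discs of the triangles through \<open>x\<close> are disjoint and lie in the disc of radius \<open>2 h\<close>
  about \<open>x\<close>; comparing areas bounds their number. This bounds the number of sides of an edge or a ridge.\<close>

lemma card_elems_at_point:
  "real (card {T \<in> Th. x \<in> T}) \<le> 4 / \<rho>\<^sup>2"
proof -
  define S where "S = {T \<in> Th. x \<in> T}"
  have S: "finite S" using finite_Th by (simp add: S_def)
  obtain z where z: "\<And>T. T \<in> Th \<Longrightarrow> ball (z T) (\<rho> * h) \<subseteq> T"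
    using bchoice[OF quasi_uniform[unfolded quasi_uniform_def]] by blast
  define B where "B T = ball (z T) (\<rho> * h)" for T
  define u where "u = measure lborel (ball (0::point) 1)"
  have u: "u > 0" unfolding u_def by (rule content_ball_pos) simp
  have ball: "measure lborel (ball y r) = r\<^sup>2 * u" if "r \<ge> 0" for y :: point and r
    using content_ball_conv_unit_ball[OF that, of y] by (simp add: u_def power2_eq_square)
  have int: "B T \<subseteq> interior T" if "T \<in> S" for T
    using that unfolding B_def S_def by (intro interior_maximal z open_ball) simp
  have sub: "B T \<subseteq> ball x (2 * h)" if "T \<in> S" for T
  proof
    fix y assume "y \<in> B T"
    then have "y \<in> T" using int[OF that] interior_subset by blast
    then have "dist x y \<le> h" using that by (auto simp: S_def intro: dist_le_h)
    then show "y \<in> ball x (2 * h)" using h_pos by simp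
  qed
  have fin: "emeasure lebesgue (B T) \<noteq> \<infinity>" for T
    using emeasure_lborel_ball_finite[of "z T" "\<rho> * h"] by (simp add: B_def)
  have "disjoint_family_on B S"
    unfolding disjoint_family_on_def
  proof (intro ballI impI equals0I)
    fix T T' y assume TT': "T \<in> S" "T' \<in> S" "T \<noteq> T'" "y \<in> B T \<inter> B T'"
    then have "y \<in> interior T" "y \<in> T'" using int interior_subset by blast+
    then show False using interiors_disjoint[of T T' y] TT' by (simp add: S_def)
  qed
  then have "measure lebesgue (\<Union>T\<in>S. B T) = (\<Sum>T\<in>S. measure lebesgue (B T))"
    using S fin by (intro measure_finite_Union) (simp_all add: B_def[abs_def] image_subset_iff)
  also have "\<dots> = real (card S) * ((\<rho> * h)\<^sup>2 * u)"
    using h_pos \<rho> by (simp add: B_def ball)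
  finally have "real (card S) * ((\<rho> * h)\<^sup>2 * u) = measure lebesgue (\<Union>T\<in>S. B T)" ..
  also have "\<dots> \<le> measure lebesgue (ball x (2 * h))"
    using sub S by (intro measure_mono_fmeasurable) (auto simp: B_def)
  also have "\<dots> = (2 * h)\<^sup>2 * u" using h_pos by (simp add: ball)
  finally have "real (card S) * (\<rho>\<^sup>2 * (h\<^sup>2 * u)) \<le> 4 * (h\<^sup>2 * u)"
    by (simp add: power_mult_distrib mult.assoc)
  moreover have "h\<^sup>2 * u > 0" using h_pos u by simp
  ultimately have "real (card S) * \<rho>\<^sup>2 \<le> 4"
    using mult_le_cancel_right_pos[of "h\<^sup>2 * u" "real (card S) * \<rho>\<^sup>2" 4] by (simp add: mult.assoc)
  then show ?thesis using \<rho> by (simp add: S_def field_simps)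
qed

end

section \<open>Averages of gradients across edges\<close>

lemma norm_sum_sq_le:
  fixes f :: "'a \<Rightarrow> 'b::real_normed_vector"
  shows "(norm (\<Sum>i\<in>I. f i))\<^sup>2 \<le> real (card I) * (\<Sum>i\<in>I. (norm (f i))\<^sup>2)"
proof -
  have "(norm (\<Sum>i\<in>I. f i))\<^sup>2 \<le> (\<Sum>i\<in>I. norm (f i))\<^sup>2"
    by (intro power_mono norm_sum) simp
  also have "\<dots> \<le> (\<Sum>i\<in>I. (norm (f i))\<^sup>2) * real (card I)"
    by (rule sum_squared_le_sum_of_squares)
  finally show ?thesis by (simp add: mult.commute)
qed

text \<open>Double counting: each \<open>e\<close> is charged at most \<open>m\<close> times for each of the shifts \<open>s\<close>.\<close>

lemma sum_incidence_le:
  fixes f :: "'e \<Rightarrow> real"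
  assumes fin: "finite X" "finite E" "finite S"
    and R: "\<And>x. x \<in> X \<Longrightarrow> R x \<subseteq> E \<times> S" and f: "\<And>e. e \<in> E \<Longrightarrow> f e \<ge> 0"
    and m: "\<And>e s. e \<in> E \<Longrightarrow> s \<in> S \<Longrightarrow> card {x \<in> X. (e, s) \<in> R x} \<le> m"
  shows "(\<Sum>x\<in>X. \<Sum>(e, s)\<in>R x. f e) \<le> real (card S * m) * (\<Sum>e\<in>E. f e)"
proof -
  have "(\<Sum>x\<in>X. \<Sum>(e, s)\<in>R x. f e) = (\<Sum>x\<in>X. \<Sum>q\<in>E \<times> S. if q \<in> R x then f (fst q) else 0)"
  proof (rule sum.cong)
    fix x assume "x \<in> X"
    then have "{q \<in> E \<times> S. q \<in> R x} = R x" using R by blast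
    then show "(\<Sum>(e, s)\<in>R x. f e) = (\<Sum>q\<in>E \<times> S. if q \<in> R x then f (fst q) else 0)"
      using sum.inter_filter[of "E \<times> S" "\<lambda>q. f (fst q)" "\<lambda>q. q \<in> R x"] fin
      by (simp add: case_prod_unfold)
  qed simp
  also have "\<dots> = (\<Sum>q\<in>E \<times> S. \<Sum>x\<in>X. if q \<in> R x then f (fst q) else 0)"
    by (rule sum.swap)
  also have "\<dots> = (\<Sum>q\<in>E \<times> S. real (card {x \<in> X. q \<in> R x}) * f (fst q))"
    using fin by (simp add: sum.inter_filter[symmetric])
  also have "\<dots> \<le> (\<Sum>q\<in>E \<times> S. real m * f (fst q))"
    using m f by (intro sum_mono mult_right_mono) auto
  also have "\<dots> = (\<Sum>e\<in>E. \<Sum>s\<in>S. real m * f e)"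
    by (simp only: sum.cartesian_product case_prod_unfold)
  also have "\<dots> = real (card S * m) * (\<Sum>e\<in>E. f e)"
    by (simp add: sum_distrib_left mult.assoc)
  finally show ?thesis .
qed

lemma card_doubleton_le: "card {x, y} \<le> 2"
  by (simp add: card_insert_if)

definition grad_const :: "nat \<Rightarrow> real \<Rightarrow> real" where
  "grad_const p \<rho> = (inverse_constant p (\<rho> / 2))\<^sup>2"

lemma grad_const_nonneg: "grad_const p \<rho> \<ge> 0"
  by (simp add: grad_const_def)

text \<open>The factor \<open>32\<close> is \<open>1/4\<close> (from squaring the average) times \<open>8\<close> (there are at most \<open>8 / \<rho>\<^sup>2\<close> sides of an edge) times
  \<open>16\<close> (two shifts and at most eight faces of a triangle).\<close>

definition avg_const :: "nat \<Rightarrow> real \<Rightarrow> real" where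
  "avg_const p \<rho> = 32 * grad_const p \<rho> / \<rho>\<^sup>2"

text \<open>The factor \<open>64\<close> is \<open>1/4\<close> times \<open>64\<close> (there are at most \<open>64 / \<rho>\<^sup>2\<close> sides of a ridge) times \<open>4\<close> (two shifts and two
  ends of an edge); the third power of \<open>\<rho>\<close> comes from the lower bound on the edge length.\<close>

definition ridge_const :: "nat \<Rightarrow> real \<Rightarrow> real" where
  "ridge_const p \<rho> = 64 * inverse_constant p 1 / \<rho> ^ 3"

context quasi_uniform_mesh
begin

lemma finite_edges: "finite edges"
proof -
  have "edges = (\<Union>T\<in>Th. {e. e edge_of T})" by (auto simp: edges_def)
  then show ?thesis using finite_Th finite_edges_of_simplex[OF simplex] by simp
qed

lemma finite_E_star: "finite E_star" and finite_E_Gamma1: "finite E_Gamma1"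
  using finite_edges by (auto simp: E_star_def E0_def E_Gamma2_def E_Gamma1_def)

lemma E_star_edges: "e \<in> E_star \<Longrightarrow> e \<in> edges" and E_Gamma1_edges: "e \<in> E_Gamma1 \<Longrightarrow> e \<in> edges"
  by (auto simp: E_star_def E0_def E_Gamma2_def E_Gamma1_def)

lemma edgeE:
  assumes "e \<in> edges" obtains T where "T \<in> Th" "e edge_of T" "e \<subseteq> T"
  using assms edge_of_imp_subset unfolding edges_def by auto

lemma edge_segment:
  assumes "e \<in> edges" obtains P Q where "e = closed_segment P Q" "P \<noteq> Q"
proof -
  obtain T where "T \<in> Th" "e edge_of T" using edgeE[OF assms] .
  then show thesis using edge_is_segment compact_elem convex_elem that by metis
qed

lemma is_segment_edge: "e \<in> edges \<Longrightarrow> is_segment e"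
  unfolding is_segment_def by (elim edge_segment) auto

lemma edge_nonempty: "e \<in> edges \<Longrightarrow> e \<noteq> {}"
  by (elim edge_segment) auto

lemma edge_dist_le_h:
  assumes "e \<in> edges" "x \<in> e" "y \<in> e" shows "dist x y \<le> h"
proof -
  obtain T where "T \<in> Th" "e \<subseteq> T" using edgeE[OF assms(1)] .
  then show ?thesis using assms by (intro dist_le_h[of T]) auto
qed

definition elem_energy :: "(point \<Rightarrow> real) \<Rightarrow> point set \<Rightarrow> real" where
  "elem_energy v T = (LINT x|lebesgue_on (interior T). (norm (grad v x))\<^sup>2)"

lemma elem_energy_nonneg: "elem_energy v T \<ge> 0"
  by (simp add: elem_energy_def)

lemma Vp_element_poly:
  assumes "v \<in> Vp" "T \<in> Th" obtains q g1 g2 where "element_poly p v T q g1 g2"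
proof -
  obtain q where "q \<in> Poly2 p" "\<And>x. x \<in> interior T \<Longrightarrow> v x = q x"
    using assms unfolding Vp_def by blast
  then show thesis
    using element_poly_exists[OF convex_elem[OF assms(2)] closed_elem[OF assms(2)] interior_elem[OF assms(2)], of q p v] that
    by metis
qed

lemma
  assumes "v \<in> Vp" "T \<in> Th"
  shows continuous_on_tr: "continuous_on T (tr v T)"
    and continuous_on_tr_grad: "continuous_on T (tr (grad v) T)"
proof -
  obtain q g1 g2 where ep: "element_poly p v T q g1 g2" using Vp_element_poly[OF assms] .
  show "continuous_on T (tr v T)"
    by (rule continuous_on_eq[OF slice_poly_continuous[OF element_poly_slice(1)[OF ep]]])
      (simp add: element_poly_tr(1)[OF ep])
  have "continuous_on T (\<lambda>x. (g1 x, g2 x))"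
    by (intro continuous_on_Pair slice_poly_continuous[OF element_poly_slice(2)[OF ep]]
        slice_poly_continuous[OF element_poly_slice(3)[OF ep]])
  then show "continuous_on T (tr (grad v) T)"
    by (rule continuous_on_eq) (simp add: element_poly_tr(2)[OF ep])
qed

lemma gradient_trace_bound:
  assumes v: "v \<in> Vp" and T: "T \<in> Th" and w: "w \<in> T"
  shows "(norm (tr (grad v) T w))\<^sup>2 \<le> grad_const p \<rho> / h\<^sup>2 * elem_energy v T"
proof -
  obtain q where q: "q \<in> Poly2 p" "\<And>x. x \<in> interior T \<Longrightarrow> v x = q x"
    using v T unfolding Vp_def by blast
  obtain z where z: "ball z (\<rho> * h) \<subseteq> T" using elem_ball[OF T] .
  show ?thesis
    using element_gradient_bound[OF convex_elem[OF T] compact_elem[OF T] z diameter_le_h[OF T] \<rho> h_pos q w]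
    by (simp add: grad_const_def elem_energy_def power_divide)
qed

lemma sides_subset: "(T, s) \<in> sides e \<Longrightarrow> T \<in> Th \<and> s \<in> {0, period} \<and> (\<forall>x\<in>e. s + x \<in> T)"
  unfolding sides_def using edge_of_imp_subset[of "(+) s ` e" T] by (simp add: image_subset_iff)

lemma card_sides_le:
  assumes "e \<in> edges"
  shows "real (card (sides e)) \<le> 8 / \<rho>\<^sup>2"
proof -
  obtain x where x: "x \<in> e" using edge_nonempty[OF assms] by blast
  have "sides e \<subseteq> {T \<in> Th. 0 + x \<in> T} \<times> {0} \<union> {T \<in> Th. period + x \<in> T} \<times> {period}"
  proof (rule subrelI)
    fix T s assume "(T, s) \<in> sides e"
    then have "T \<in> Th" "s = 0 \<or> s = period" "s + x \<in> T" using sides_subset x by auto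
    then show "(T, s) \<in> {T \<in> Th. 0 + x \<in> T} \<times> {0} \<union> {T \<in> Th. period + x \<in> T} \<times> {period}" by auto
  qed
  then have "card (sides e) \<le> card ({T \<in> Th. 0 + x \<in> T} \<times> {0::point} \<union> {T \<in> Th. period + x \<in> T} \<times> {period})"
    using finite_Th by (intro card_mono) auto
  also have "\<dots> \<le> card {T \<in> Th. 0 + x \<in> T} + card {T \<in> Th. period + x \<in> T}"
    by (rule order_trans[OF card_Un_le]) (simp add: card_cartesian_product)
  finally show ?thesis
    using card_elems_at_point[of "0 + x"] card_elems_at_point[of "period + x"] by linarith
qed

lemma continuous_on_side:
  assumes "continuous_on T F" "(T, s) \<in> sides e"
  shows "continuous_on e (\<lambda>x. F (s + x))"
  by (rule continuous_on_compose2[OF assms(1)]) (use sides_subset[OF assms(2)] in \<open>auto intro!: continuous_intros\<close>)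

lemma
  assumes v: "v \<in> Vp"
  shows continuous_on_jump: "continuous_on e (jump v e)"
    and continuous_on_avg: "continuous_on e (avg (grad v) e)"
proof -
  have 1: "continuous_on e (\<lambda>x. tr v (fst q) (snd q + x))" "continuous_on e (\<lambda>x. tr (grad v) (fst q) (snd q + x))"
    if q: "q \<in> sides e" for q
  proof -
    have q': "(fst q, snd q) \<in> sides e" using q by simp
    then have T: "fst q \<in> Th" using sides_subset by blast
    show "continuous_on e (\<lambda>x. tr v (fst q) (snd q + x))" "continuous_on e (\<lambda>x. tr (grad v) (fst q) (snd q + x))"
      by (rule continuous_on_side[OF _ q'], rule continuous_on_tr[OF v T] continuous_on_tr_grad[OF v T])+
  qed
  show "continuous_on e (jump v e)"
    unfolding jump_def[abs_def] case_prod_unfold by (intro continuous_intros 1)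
  show "continuous_on e (avg (grad v) e)"
    unfolding avg_def[abs_def] case_prod_unfold by (intro continuous_intros 1)
qed

lemma edge_avg_bound:
  assumes v: "v \<in> Vp" and e: "e \<in> edges"
  shows "seg_int e (\<lambda>x. (norm (avg (grad v) e x))\<^sup>2)
    \<le> 2 * grad_const p \<rho> / (\<rho>\<^sup>2 * h) * (\<Sum>(T, s)\<in>sides e. elem_energy v T)"
proof -
  define M where "M = 2 / \<rho>\<^sup>2 * (grad_const p \<rho> / h\<^sup>2) * (\<Sum>(T, s)\<in>sides e. elem_energy v T)"
  have en: "(\<Sum>(T, s)\<in>sides e. elem_energy v T) \<ge> 0"
    by (intro sum_nonneg) (auto simp: elem_energy_nonneg)
  have "(norm (avg (grad v) e x))\<^sup>2 \<le> M" if x: "x \<in> e" for x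
  proof -
    have "(norm (avg (grad v) e x))\<^sup>2 = 1 / 4 * (norm (\<Sum>(T, s)\<in>sides e. tr (grad v) T (s + x)))\<^sup>2"
      by (simp add: avg_def power_mult_distrib power_divide)
    also have "\<dots> \<le> 1 / 4 * (real (card (sides e)) * (\<Sum>(T, s)\<in>sides e. (norm (tr (grad v) T (s + x)))\<^sup>2))"
      using norm_sum_sq_le[of "\<lambda>(T, s). tr (grad v) T (s + x)" "sides e"] by (simp add: case_prod_unfold)
    also have "\<dots> \<le> 1 / 4 * (8 / \<rho>\<^sup>2 * (\<Sum>(T, s)\<in>sides e. grad_const p \<rho> / h\<^sup>2 * elem_energy v T))"
    proof (intro mult_left_mono mult_mono card_sides_le e sum_mono)
      show "(case q of (T, s) \<Rightarrow> (norm (tr (grad v) T (s + x)))\<^sup>2)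
          \<le> (case q of (T, s) \<Rightarrow> grad_const p \<rho> / h\<^sup>2 * elem_energy v T)" if "q \<in> sides e" for q
        using that sides_subset[of "fst q" "snd q" e] gradient_trace_bound[OF v] x
        by (auto simp: case_prod_unfold)
    qed (auto simp: case_prod_unfold intro: sum_nonneg)
    also have "\<dots> = M" unfolding M_def by (simp add: sum_distrib_left case_prod_unfold mult.assoc)
    finally show ?thesis .
  qed
  then have "seg_int e (\<lambda>x. (norm (avg (grad v) e x))\<^sup>2) \<le> h * M"
    using en grad_const_nonneg
    by (intro seg_int_le_diameter is_segment_edge e edge_dist_le_h[OF e] continuous_intros continuous_on_avg v)
      (auto simp: M_def)
  also have "h * M = 2 * grad_const p \<rho> / (\<rho>\<^sup>2 * h) * (\<Sum>(T, s)\<in>sides e. elem_energy v T)"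
    using h_pos by (simp add: M_def power2_eq_square)
  finally show ?thesis .
qed

text \<open>The term \<open>\<parallel>{\<nabla>v}\<parallel>\<^sup>2\<close> over all edges costs a factor \<open>1 / h\<close>, which the weight \<open>1 / \<sigma> = h / \<gamma>\<close> cancels.\<close>

lemma sum_avg_bound:
  assumes v: "v \<in> Vp"
  shows "(\<Sum>e\<in>E_star. seg_int e (\<lambda>x. (norm (avg (grad v) e x))\<^sup>2)) \<le> avg_const p \<rho> / h * (\<Sum>T\<in>Th. elem_energy v T)"
proof -
  have k: "2 * grad_const p \<rho> / (\<rho>\<^sup>2 * h) \<ge> 0" using grad_const_nonneg h_pos by simp
  have "(\<Sum>e\<in>E_star. seg_int e (\<lambda>x. (norm (avg (grad v) e x))\<^sup>2))
      \<le> (\<Sum>e\<in>E_star. 2 * grad_const p \<rho> / (\<rho>\<^sup>2 * h) * (\<Sum>(T, s)\<in>sides e. elem_energy v T))"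
    by (intro sum_mono edge_avg_bound v E_star_edges)
  also have "\<dots> = 2 * grad_const p \<rho> / (\<rho>\<^sup>2 * h) * (\<Sum>e\<in>E_star. \<Sum>(T, s)\<in>sides e. elem_energy v T)"
    by (simp add: sum_distrib_left)
  finally have le: "(\<Sum>e\<in>E_star. seg_int e (\<lambda>x. (norm (avg (grad v) e x))\<^sup>2))
      \<le> 2 * grad_const p \<rho> / (\<rho>\<^sup>2 * h) * (\<Sum>e\<in>E_star. \<Sum>(T, s)\<in>sides e. elem_energy v T)" .
  have "(\<Sum>e\<in>E_star. \<Sum>(T, s)\<in>sides e. elem_energy v T)
      \<le> real (card {0, period} * 8) * (\<Sum>T\<in>Th. elem_energy v T)"
  proof (rule sum_incidence_le[OF finite_E_star finite_Th])
    fix T s assume T: "T \<in> Th"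
    have "card {e \<in> E_star. (T, s) \<in> sides e} = card ((`) ((+) s) ` {e \<in> E_star. (T, s) \<in> sides e})"
      by (intro card_image[symmetric] inj_onI) (simp add: inj_image_eq_iff)
    also have "\<dots> \<le> card {e. e edge_of T}"
      using finite_edges_of_simplex[OF simplex[OF T]] by (intro card_mono) (auto simp: sides_def)
    also have "\<dots> \<le> 8" by (rule card_edges_of_simplex[OF simplex[OF T]])
    finally show "card {e \<in> E_star. (T, s) \<in> sides e} \<le> 8" .
  qed (auto dest: sides_subset simp: elem_energy_nonneg)
  also have "\<dots> \<le> 16 * (\<Sum>T\<in>Th. elem_energy v T)"
    using card_doubleton_le[of 0 period]
    by (intro mult_right_mono sum_nonneg elem_energy_nonneg) auto
  finally have "(\<Sum>e\<in>E_star. \<Sum>(T, s)\<in>sides e. elem_energy v T) \<le> 16 * (\<Sum>T\<in>Th. elem_energy v T)" .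
  from mult_left_mono[OF this k] le show ?thesis by (simp add: avg_const_def)
qed

end

section \<open>Traces on the horizontal boundary and coercivity\<close>

text \<open>The algebra common to \<open>B_form\<close> and \<open>b_form\<close>: \<open>X\<close> is the energy, \<open>J\<close> the jump term, \<open>A\<close> the average
  term. Young's inequality gives half of the penalty and \<open>2 A / \<sigma>\<close> for the two consistency terms, and
  \<open>A / \<sigma> \<le> X / 8\<close> once \<open>\<gamma>\<close> is large.\<close>

lemma symmetric_penalty_coercive:
  fixes X J A cross C \<gamma> h \<sigma> :: real
  assumes pos: "X \<ge> 0" "h > 0" "\<gamma> > 0" "\<sigma> = \<gamma> / h" and \<gamma>: "8 * C \<le> \<gamma>"
    and A: "A \<le> C / h * X" and cross: "cross \<le> \<sigma> / 4 * J + 1 / \<sigma> * A"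
  shows "X - cross - cross + \<sigma> * J \<ge> 1 / 2 * (X + \<sigma> * J + 1 / \<sigma> * A)"
proof -
  have "1 / \<sigma> * A \<le> 1 / \<sigma> * (C / h * X)" using A pos by (intro mult_left_mono) auto
  also have "\<dots> = (C / \<gamma>) * X" using pos by simp
  also have "\<dots> \<le> 1 / 8 * X" using pos \<gamma> by (intro mult_right_mono) (auto simp: field_simps)
  finally have "1 / \<sigma> * A \<le> 1 / 8 * X" .
  with cross pos(1) show ?thesis by argo
qed

lemma inner_le_weighted:
  fixes x y :: "'a::real_inner"
  assumes "s > 0" shows "x \<bullet> y \<le> s / 4 * (norm x)\<^sup>2 + 1 / s * (norm y)\<^sup>2"
proof -
  have "0 \<le> (norm ((s / 2) *\<^sub>R x - y))\<^sup>2" by simp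
  also have "\<dots> = s * (s / 4 * (norm x)\<^sup>2 + 1 / s * (norm y)\<^sup>2 - x \<bullet> y)"
    using assms unfolding power2_norm_eq_inner
    by (simp add: inner_diff_left inner_diff_right inner_commute algebra_simps)
  finally show ?thesis using assms by (simp add: zero_le_mult_iff)
qed

context quasi_uniform_mesh
begin

definition vertices :: "point set" where
  "vertices = {r. \<exists>T\<in>Th. r extreme_point_of T}"

lemma finite_vertices: "finite vertices"
proof -
  have "finite {r. r extreme_point_of T}" if T: "T \<in> Th" for T
  proof -
    obtain A B C where "T = convex hull {A, B, C}" using two_simplexE[OF simplex[OF T]] by metis
    then show ?thesis using extreme_points_of_convex_hull[of "{A, B, C}"] by (simp add: finite_subset)
  qed
  moreover have "vertices = (\<Union>T\<in>Th. {r. r extreme_point_of T})" by (auto simp: vertices_def)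
  ultimately show ?thesis using finite_Th by simp
qed

text \<open>At a point of the top or bottom of the rectangle that is not a mesh vertex, a single triangle fills the
  rectangle locally. This makes the triangle adjacent to a boundary edge unique and the trace
  \<open>tr_Gamma1\<close> equal to a polynomial value there.\<close>

lemma boundary_neighbourhood:
  assumes T: "T \<in> Th" "z \<in> T" and z: "z \<in> Gamma1" "z \<notin> vertices"
  obtains \<epsilon> where "\<epsilon> > 0" "\<forall>w. dist z w < \<epsilon> \<longrightarrow> w \<in> {a..b} \<times> {c..d} \<longrightarrow> w \<in> T"
proof -
  define s :: real where "s = (if snd z = c then 1 else -1)"
  have z': "snd z = c \<or> snd z = d" using z(1) by (auto simp: Gamma1_def)
  have f: "s * (snd w - snd z) \<ge> 0" if "w \<in> {a..b} \<times> {c..d}" for w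
    using that z' by (auto simp: s_def)
  have "\<exists>\<epsilon>>0. \<forall>w. dist z w < \<epsilon> \<and> s * (snd w - snd z) \<ge> 0 \<longrightarrow> w \<in> T"
  proof (rule half_ball[OF simplex[OF T(1)] refl])
    show "s \<noteq> 0" by (simp add: s_def)
    show "s * (snd w - snd z) \<ge> 0" if "w \<in> T" for w
      using f subsetD[OF elem_subset[OF T(1)] that] .
    show "\<not> z extreme_point_of T" using z(2) T(1) by (auto simp: vertices_def)
  qed (use T in simp_all)
  then obtain \<epsilon> where \<epsilon>: "\<epsilon> > 0" "\<forall>w. dist z w < \<epsilon> \<and> s * (snd w - snd z) \<ge> 0 \<longrightarrow> w \<in> T"
    by (elim exE conjE)
  have "\<forall>w. dist z w < \<epsilon> \<longrightarrow> w \<in> {a..b} \<times> {c..d} \<longrightarrow> w \<in> T"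
    using \<epsilon>(2) f by blast
  with \<epsilon>(1) show thesis by (rule that)
qed

lemma boundary_elem_unique:
  assumes T: "T \<in> Th" "z \<in> T" and T': "T' \<in> Th" "z \<in> T'" and z: "z \<in> Gamma1" "z \<notin> vertices"
  shows "T = T'"
proof -
  obtain \<epsilon> where \<epsilon>: "\<epsilon> > 0" "\<forall>w. dist z w < \<epsilon> \<longrightarrow> w \<in> {a..b} \<times> {c..d} \<longrightarrow> w \<in> T"
    using boundary_neighbourhood[OF T z] .
  have "z \<in> closure (interior T')"
    using convex_closure_interior[OF convex_elem interior_elem] closed_elem T' by simp
  then obtain w where w: "w \<in> interior T'" "dist w z < \<epsilon>"
    using \<epsilon>(1) closure_approachable by blast
  then have "w \<in> T'" using interior_subset by blast
  then have "w \<in> T" using \<epsilon>(2)[rule_format, of w] w(2) subsetD[OF elem_subset[OF T'(1)]] by (simp only: dist_commute)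
  then show ?thesis using interiors_disjoint[OF T'(1) T(1) w(1)] by simp
qed

lemma tr_Gamma1_eq:
  assumes T: "T \<in> Th" "z \<in> T" and z: "z \<in> Gamma1" "z \<notin> vertices"
    and v: "\<And>x. x \<in> interior T \<Longrightarrow> v x = q x" and cont: "isCont q z"
  shows "tr_Gamma1 v z = q z"
proof -
  define U where "U = (\<Union>T\<in>Th. interior T)"
  obtain \<epsilon> where \<epsilon>: "\<epsilon> > 0" "\<forall>w. dist z w < \<epsilon> \<longrightarrow> w \<in> {a..b} \<times> {c..d} \<longrightarrow> w \<in> T"
    using boundary_neighbourhood[OF T z] .
  have "at z within interior T \<noteq> bot"
    using at_within_interior_neq_bot[OF convex_elem closed_elem interior_elem T(2)] T(1) by simp
  moreover have "at z within interior T \<le> at z within U"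
    using T(1) by (intro at_le) (auto simp: U_def)
  ultimately have ne: "at z within U \<noteq> bot" by (metis bot.extremum_uniqueI)
  have eq: "v w = q w" if w: "w \<in> U" "dist w z < \<epsilon>" for w
  proof -
    obtain T' where T': "T' \<in> Th" "w \<in> interior T'" using w(1) by (auto simp: U_def)
    then have "w \<in> T'" using interior_subset by blast
    then have "w \<in> T" using \<epsilon>(2)[rule_format, of w] w(2) subsetD[OF elem_subset[OF T'(1)]] by (simp only: dist_commute)
    then have "T' = T" using interiors_disjoint[OF T'(1) T(1) T'(2)] by simp
    then show ?thesis using v T' by simp
  qed
  have "(q \<longlongrightarrow> q z) (at z within U)"
    using cont continuous_at_imp_continuous_at_within continuous_within by blast
  moreover have "\<forall>\<^sub>F w in at z within U. q w = v w"
    unfolding eventually_at using \<epsilon>(1) eq by (intro exI[of _ \<epsilon>]) simp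
  ultimately have "(v \<longlongrightarrow> q z) (at z within U)"
    by (rule Lim_transform_eventually)
  then show ?thesis
    unfolding tr_Gamma1_def U_def[symmetric] using ne by (intro tendsto_Lim)
qed

text \<open>An edge has more points than there are vertices, and a boundary point that is not a vertex lies in
  one triangle only.\<close>

lemma tri_eq:
  assumes e: "e \<in> E_Gamma1" and T: "T \<in> Th" "e edge_of T"
  shows "tri e = T"
proof -
  obtain P Q where PQ: "e = closed_segment P Q" "P \<noteq> Q" using edge_segment[OF E_Gamma1_edges[OF e]] .
  have "uncountable e" unfolding PQ(1) by (rule uncountable_closed_segment[OF PQ(2)])
  then have "\<not> e \<subseteq> vertices"
    using countable_finite[OF finite_subset[OF _ finite_vertices, of e]] by (rule contrapos_nn)
  then have "e - vertices \<noteq> {}" unfolding Diff_eq_empty_iff .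
  then obtain z where "z \<in> e - vertices" unfolding ex_in_conv[symmetric] by (elim exE)
  then have z: "z \<in> e" "z \<notin> vertices" by simp_all
  have "e \<subseteq> Gamma1" using e by (simp add: E_Gamma1_def)
  then have "z \<in> Gamma1" using z(1) by (rule subsetD)
  have uniq: "T' = T" if T': "T' \<in> Th" "e edge_of T'" for T'
  proof (rule boundary_elem_unique[OF T'(1) _ T(1) _ \<open>z \<in> Gamma1\<close> z(2)])
    show "z \<in> T'" by (rule subsetD[OF edge_of_imp_subset[OF T'(2)] z(1)])
    show "z \<in> T" by (rule subsetD[OF edge_of_imp_subset[OF T(2)] z(1)])
  qed
  show ?thesis unfolding tri_def
  proof (rule the_equality)
    show "T \<in> Th \<and> e edge_of T" using T by blast
    show "T' = T" if "T' \<in> Th \<and> e edge_of T'" for T' using uniq that by blast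
  qed
qed

lemma tri:
  assumes "e \<in> E_Gamma1" shows "tri e \<in> Th" "e edge_of tri e" "e \<subseteq> tri e"
proof -
  obtain T where "T \<in> Th" "e edge_of T" "e \<subseteq> T" using edgeE[OF E_Gamma1_edges[OF assms]] .
  then show "tri e \<in> Th" "e edge_of tri e" "e \<subseteq> tri e" using tri_eq[OF assms] by simp_all
qed

text \<open>A segment joining the top to the bottom would have its midpoint off \<open>Gamma1\<close>.\<close>

lemma E_Gamma1_horizontal:
  assumes e: "e \<in> E_Gamma1"
  obtains x1 x2 y where "e = closed_segment (x1, y) (x2, y)" "2 * \<rho> * h \<le> \<bar>x2 - x1\<bar>"
proof -
  obtain P Q where PQ: "e = closed_segment P Q" "P \<noteq> Q" using edge_segment[OF E_Gamma1_edges[OF e]] .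
  have G: "snd w \<in> {c, d}" if "w \<in> e" for w
    using that e by (auto simp: E_Gamma1_def Gamma1_def)
  have "snd P \<in> {c, d}" "snd Q \<in> {c, d}" "snd (midpoint P Q) \<in> {c, d}"
    using G PQ(1) by simp_all
  then have y: "snd P = snd Q" using cd by (auto simp: midpoint_def)
  have "Q = (fst Q, snd P)" using y by (simp add: prod_eq_iff)
  then have eq: "e = closed_segment (fst P, snd P) (fst Q, snd P)" using PQ(1) by simp
  obtain z where z: "ball z (\<rho> * h) \<subseteq> tri e" using elem_ball[OF tri(1)[OF e]] .
  have "2 * (\<rho> * h) \<le> dist P Q"
    using edge_length_ge[OF simplex[OF tri(1)[OF e]] _ z] tri(2)[OF e] PQ(1) by simp
  also have "dist P Q = \<bar>fst Q - fst P\<bar>"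
    using y by (cases P; cases Q) (simp add: dist_Pair_Pair dist_real_def abs_minus_commute)
  finally have "2 * \<rho> * h \<le> \<bar>fst Q - fst P\<bar>" by (simp add: mult.assoc)
  with eq show thesis by (rule that)
qed

text \<open>The normal is constant on \<open>e\<close>, so the tangential projection only forms linear combinations of the
  components of the gradient.\<close>

lemma tgrad_slice_poly:
  assumes v: "v \<in> Vp" and e: "e \<in> E_Gamma1"
  obtains G1 G2 where "slice_poly p G1" "slice_poly p G2" "\<forall>x\<in>e. tgrad v e x = (G1 x, G2 x)"
proof -
  obtain q g1 g2 where ep: "element_poly p v (tri e) q g1 g2" using Vp_element_poly[OF v tri(1)[OF e]] .
  obtain n1 n2 where n: "outer_normal (tri e) e = (n1, n2)" by fastforce
  have "slice_poly p (\<lambda>x. (1 - n1 * n1) * g1 x + (- n1 * n2) * g2 x)"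
    "slice_poly p (\<lambda>x. (- n1 * n2) * g1 x + (1 - n2 * n2) * g2 x)"
    by (intro slice_poly_add slice_poly_cmult element_poly_slice[OF ep])+
  moreover have "\<forall>x\<in>e. tgrad v e x = ((1 - n1 * n1) * g1 x + (- n1 * n2) * g2 x, (- n1 * n2) * g1 x + (1 - n2 * n2) * g2 x)"
  proof
    fix x assume "x \<in> e"
    then have "tr (grad v) (tri e) x = (g1 x, g2 x)"
      by (intro element_poly_tr(2)[OF ep] subsetD[OF tri(3)[OF e]])
    then show "tgrad v e x = ((1 - n1 * n1) * g1 x + (- n1 * n2) * g2 x, (- n1 * n2) * g1 x + (1 - n2 * n2) * g2 x)"
      by (simp add: tgrad_def Let_def n algebra_simps)
  qed
  ultimately show thesis by (rule that)
qed

definition tgrad_energy :: "(point \<Rightarrow> real) \<Rightarrow> point set \<Rightarrow> real" where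
  "tgrad_energy v e = seg_int e (\<lambda>x. (norm (tgrad v e x))\<^sup>2)"

lemma tgrad_energy_nonneg: "e \<in> E_Gamma1 \<Longrightarrow> tgrad_energy v e \<ge> 0"
  unfolding tgrad_energy_def by (intro seg_int_nonneg is_segment_edge E_Gamma1_edges) simp_all

lemma tgrad_bound:
  assumes v: "v \<in> Vp" and e: "e \<in> E_Gamma1" and x: "x \<in> e"
  shows "(norm (tgrad v e x))\<^sup>2 \<le> inverse_constant p 1 / (\<rho> * h) * tgrad_energy v e"
proof -
  obtain G1 G2 where G: "slice_poly p G1" "slice_poly p G2" "\<forall>x\<in>e. tgrad v e x = (G1 x, G2 x)"
    using tgrad_slice_poly[OF v e] .
  obtain x1 x2 y where xy: "e = closed_segment (x1, y) (x2, y)" "2 * \<rho> * h \<le> \<bar>x2 - x1\<bar>"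
    using E_Gamma1_horizontal[OF e] .
  have seg: "is_segment e" using e by (intro is_segment_edge E_Gamma1_edges)
  have "tgrad_energy v e = seg_int e (\<lambda>x. 1 * (G1 x)\<^sup>2 + 1 * (G2 x)\<^sup>2)"
    unfolding tgrad_energy_def by (rule seg_int_cong[OF seg]) (simp add: G(3) norm_Pair)
  also have "\<dots> = 1 * seg_int e (\<lambda>x. (G1 x)\<^sup>2) + 1 * seg_int e (\<lambda>x. (G2 x)\<^sup>2)"
    by (intro seg_int_lincomb seg continuous_intros slice_poly_continuous[OF G(1)] slice_poly_continuous[OF G(2)])
  finally have en: "tgrad_energy v e = seg_int e (\<lambda>x. (G1 x)\<^sup>2) + seg_int e (\<lambda>x. (G2 x)\<^sup>2)" by simp
  have "2 * \<rho> * h * (norm (tgrad v e x))\<^sup>2 \<le> \<bar>x2 - x1\<bar> * ((G1 x)\<^sup>2 + (G2 x)\<^sup>2)"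
    using xy(2) by (simp add: bspec[OF G(3) x] norm_Pair mult_right_mono)
  also have "\<dots> = \<bar>x2 - x1\<bar> * (G1 x)\<^sup>2 + \<bar>x2 - x1\<bar> * (G2 x)\<^sup>2" by (rule distrib_left)
  also have "\<dots> \<le> 2 * inverse_constant p 1 * seg_int e (\<lambda>x. (G1 x)\<^sup>2)
      + 2 * inverse_constant p 1 * seg_int e (\<lambda>x. (G2 x)\<^sup>2)"
    by (intro add_mono horizontal_segment_inverse_inequality[OF _ xy(1) x] G)
  also have "\<dots> = 2 * inverse_constant p 1 * tgrad_energy v e" by (simp add: en algebra_simps)
  finally show ?thesis using h_pos \<rho> by (simp add: field_simps)
qed

lemma finite_ridges: "finite ridges"
  using finite_vertices by (rule finite_subset[rotated]) (auto simp: ridges_def vertices_def)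

lemma ridge_sidesD:
  assumes "(e, s) \<in> ridge_sides r"
  shows "e \<in> E_Gamma1" "s \<in> {0, period}" "s + r \<in> e"
  using assms by (auto simp: ridge_sides_def extreme_point_of_def)

text \<open>Each side of a ridge is an edge of a triangle that contains the ridge or its translate.\<close>

lemma card_ridge_sides_le: "real (card (ridge_sides r)) \<le> 64 / \<rho>\<^sup>2"
proof -
  define E where "E x = (\<Union>T\<in>{T \<in> Th. x \<in> T}. {e. e edge_of T})" for x
  have fin: "finite (E x)" for x
    unfolding E_def using finite_Th finite_edges_of_simplex[OF simplex] by simp
  have card: "real (card (E x)) \<le> 32 / \<rho>\<^sup>2" for x
  proof -
    have "card (E x) \<le> (\<Sum>T\<in>{T \<in> Th. x \<in> T}. card {e. e edge_of T})"
      unfolding E_def using finite_Th by (intro card_UN_le) simp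
    also have "\<dots> \<le> (\<Sum>T\<in>{T \<in> Th. x \<in> T}. 8)"
      by (intro sum_mono card_edges_of_simplex simplex) simp
    finally have "card (E x) \<le> 8 * card {T \<in> Th. x \<in> T}" by simp
    then show ?thesis using card_elems_at_point[of x] by (simp flip: of_nat_le_iff)
  qed
  have "ridge_sides r \<subseteq> E (0 + r) \<times> {0} \<union> E (period + r) \<times> {period}"
  proof (rule subrelI)
    fix e s assume es: "(e, s) \<in> ridge_sides r"
    have "tri e \<in> Th" "e edge_of tri e" "s + r \<in> tri e"
      using tri[OF ridge_sidesD(1)[OF es]] ridge_sidesD(3)[OF es] by auto
    then have "e \<in> E (s + r)" unfolding E_def by blast
    then show "(e, s) \<in> E (0 + r) \<times> {0} \<union> E (period + r) \<times> {period}"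
      using ridge_sidesD(2)[OF es] by auto
  qed
  then have "card (ridge_sides r) \<le> card (E (0 + r) \<times> {0::point} \<union> E (period + r) \<times> {period})"
    using fin by (intro card_mono) auto
  also have "\<dots> \<le> card (E (0 + r)) + card (E (period + r))"
    by (rule order_trans[OF card_Un_le]) (simp add: card_cartesian_product)
  finally show ?thesis using card[of "0 + r"] card[of "period + r"] by linarith
qed

lemma sum_ridge_avg_bound:
  assumes v: "v \<in> Vp"
  shows "(\<Sum>r\<in>ridges. (norm (ridge_avg_tgrad v r))\<^sup>2) \<le> ridge_const p \<rho> / h * (\<Sum>e\<in>E_Gamma1. tgrad_energy v e)"
proof -
  define K where "K = inverse_constant p 1 / (\<rho> * h)"
  have K: "K \<ge> 0" using inverse_constant_pos[of 1 p] h_pos \<rho> by (simp add: K_def less_imp_le)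
  have point: "(norm (ridge_avg_tgrad v r))\<^sup>2 \<le> 16 / \<rho>\<^sup>2 * K * (\<Sum>(e, s)\<in>ridge_sides r. tgrad_energy v e)" for r
  proof -
    have "(norm (ridge_avg_tgrad v r))\<^sup>2 = 1 / 4 * (norm (\<Sum>(e, s)\<in>ridge_sides r. tgrad v e (s + r)))\<^sup>2"
      by (simp add: ridge_avg_tgrad_def power_mult_distrib power_divide)
    also have "\<dots> \<le> 1 / 4 * (real (card (ridge_sides r)) * (\<Sum>(e, s)\<in>ridge_sides r. (norm (tgrad v e (s + r)))\<^sup>2))"
      using norm_sum_sq_le[of "\<lambda>(e, s). tgrad v e (s + r)" "ridge_sides r"] by (simp add: case_prod_unfold)
    also have "\<dots> \<le> 1 / 4 * (64 / \<rho>\<^sup>2 * (\<Sum>(e, s)\<in>ridge_sides r. K * tgrad_energy v e))"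
    proof (intro mult_left_mono mult_mono card_ridge_sides_le sum_mono)
      show "(case q of (e, s) \<Rightarrow> (norm (tgrad v e (s + r)))\<^sup>2) \<le> (case q of (e, s) \<Rightarrow> K * tgrad_energy v e)"
        if "q \<in> ridge_sides r" for q
        using that ridge_sidesD[of "fst q" "snd q" r] tgrad_bound[OF v] by (simp add: case_prod_unfold K_def)
    qed (auto simp: case_prod_unfold intro: sum_nonneg)
    also have "\<dots> = 16 / \<rho>\<^sup>2 * K * (\<Sum>(e, s)\<in>ridge_sides r. tgrad_energy v e)"
      by (simp add: sum_distrib_left case_prod_unfold mult.assoc)
    finally show ?thesis .
  qed
  have "(\<Sum>r\<in>ridges. (norm (ridge_avg_tgrad v r))\<^sup>2)
      \<le> (\<Sum>r\<in>ridges. 16 / \<rho>\<^sup>2 * K * (\<Sum>(e, s)\<in>ridge_sides r. tgrad_energy v e))"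
    by (intro sum_mono point)
  also have "\<dots> = 16 / \<rho>\<^sup>2 * K * (\<Sum>r\<in>ridges. \<Sum>(e, s)\<in>ridge_sides r. tgrad_energy v e)"
    by (simp add: sum_distrib_left)
  finally have le: "(\<Sum>r\<in>ridges. (norm (ridge_avg_tgrad v r))\<^sup>2)
      \<le> 16 / \<rho>\<^sup>2 * K * (\<Sum>r\<in>ridges. \<Sum>(e, s)\<in>ridge_sides r. tgrad_energy v e)" .
  have "(\<Sum>r\<in>ridges. \<Sum>(e, s)\<in>ridge_sides r. tgrad_energy v e)
      \<le> real (card {0, period} * 2) * (\<Sum>e\<in>E_Gamma1. tgrad_energy v e)"
  proof (rule sum_incidence_le[OF finite_ridges finite_E_Gamma1])
    fix e s assume e: "e \<in> E_Gamma1"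
    obtain P Q where PQ: "e = closed_segment P Q" using edge_segment[OF E_Gamma1_edges[OF e]] .
    have "{r \<in> ridges. (e, s) \<in> ridge_sides r} \<subseteq> {P - s, Q - s}"
      by (auto simp: ridge_sides_def PQ extreme_point_of_segment eq_diff_eq add.commute)
    then have "card {r \<in> ridges. (e, s) \<in> ridge_sides r} \<le> card {P - s, Q - s}"
      by (intro card_mono) auto
    then show "card {r \<in> ridges. (e, s) \<in> ridge_sides r} \<le> 2"
      using card_doubleton_le[of "P - s" "Q - s"] by linarith
  qed (auto dest: ridge_sidesD simp: tgrad_energy_nonneg)
  also have "\<dots> \<le> 4 * (\<Sum>e\<in>E_Gamma1. tgrad_energy v e)"
    using card_doubleton_le[of 0 period]
    by (intro mult_right_mono sum_nonneg tgrad_energy_nonneg) auto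
  finally have "(\<Sum>r\<in>ridges. \<Sum>(e, s)\<in>ridge_sides r. tgrad_energy v e) \<le> 4 * (\<Sum>e\<in>E_Gamma1. tgrad_energy v e)" .
  moreover have "16 / \<rho>\<^sup>2 * K \<ge> 0" using K by simp
  ultimately have "16 / \<rho>\<^sup>2 * K * (\<Sum>r\<in>ridges. \<Sum>(e, s)\<in>ridge_sides r. tgrad_energy v e)
      \<le> 16 / \<rho>\<^sup>2 * K * (4 * (\<Sum>e\<in>E_Gamma1. tgrad_energy v e))"
    by (rule mult_left_mono)
  also have "\<dots> = ridge_const p \<rho> / h * (\<Sum>e\<in>E_Gamma1. tgrad_energy v e)"
    using \<rho> h_pos by (simp add: ridge_const_def K_def power2_eq_square power3_eq_cube)
  finally show ?thesis using le by linarith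
qed

text \<open>The absorption argument is applied to \<open>B_form\<close> with the energies of the triangles and to \<open>b_form\<close> with
  those of the boundary edges.\<close>

lemma A_form_coercive:
  assumes v: "v \<in> Vp" and pos: "\<gamma> > 0" "\<alpha> \<ge> 0" "\<beta> \<ge> 0"
    and \<gamma>: "8 * avg_const p \<rho> \<le> \<gamma>" "8 * ridge_const p \<rho> \<le> \<gamma>"
  shows "1 / 2 * star_norm_sq v \<le> A_form v v"
proof -
  have \<sigma>: "\<sigma> > 0" using pos h_pos by (simp add: \<sigma>_def)
  define X where "X = (\<Sum>T\<in>Th. elem_energy v T)"
  define J where "J = (\<Sum>e\<in>E_star. seg_int e (\<lambda>x. (norm (jump v e x))\<^sup>2))"
  define A where "A = (\<Sum>e\<in>E_star. seg_int e (\<lambda>x. (norm (avg (grad v) e x))\<^sup>2))"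
  define N where "N = (\<Sum>e\<in>E_star. seg_int e (\<lambda>x. jump v e x \<bullet> avg (grad v) e x))"
  define X' where "X' = (\<Sum>e\<in>E_Gamma1. tgrad_energy v e)"
  define J' where "J' = (\<Sum>r\<in>ridges. (norm (ridge_jump v r))\<^sup>2)"
  define A' where "A' = (\<Sum>r\<in>ridges. (norm (ridge_avg_tgrad v r))\<^sup>2)"
  define N' where "N' = (\<Sum>r\<in>ridges. ridge_jump v r \<bullet> ridge_avg_tgrad v r)"
  define G where "G = ip_Gamma1 (tr_Gamma1 v) (tr_Gamma1 v)"
  have G: "G \<ge> 0" unfolding G_def ip_Gamma1_def ip_def by (intro sum_nonneg) simp
  have X: "X \<ge> 0" "X' \<ge> 0"
    unfolding X_def X'_def by (intro sum_nonneg elem_energy_nonneg tgrad_energy_nonneg; assumption)+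
  have N: "N \<le> \<sigma> / 4 * J + 1 / \<sigma> * A"
  proof -
    have "N \<le> (\<Sum>e\<in>E_star. \<sigma> / 4 * seg_int e (\<lambda>x. (norm (jump v e x))\<^sup>2)
        + 1 / \<sigma> * seg_int e (\<lambda>x. (norm (avg (grad v) e x))\<^sup>2))"
      unfolding N_def
    proof (rule sum_mono)
      fix e assume "e \<in> E_star"
      then have seg: "is_segment e" by (intro is_segment_edge E_star_edges)
      note c = continuous_on_jump[OF v, of e] continuous_on_avg[OF v, of e]
      have cont: "continuous_on e (\<lambda>x. jump v e x \<bullet> avg (grad v) e x)"
        "continuous_on e (\<lambda>x. (norm (jump v e x))\<^sup>2)"
        "continuous_on e (\<lambda>x. (norm (avg (grad v) e x))\<^sup>2)"
        "continuous_on e (\<lambda>x. \<sigma> / 4 * (norm (jump v e x))\<^sup>2 + 1 / \<sigma> * (norm (avg (grad v) e x))\<^sup>2)"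
        by (rule continuous_intros c)+
      have "seg_int e (\<lambda>x. jump v e x \<bullet> avg (grad v) e x)
          \<le> seg_int e (\<lambda>x. \<sigma> / 4 * (norm (jump v e x))\<^sup>2 + 1 / \<sigma> * (norm (avg (grad v) e x))\<^sup>2)"
        by (intro seg_int_mono seg inner_le_weighted \<sigma> cont)
      also have "\<dots> = \<sigma> / 4 * seg_int e (\<lambda>x. (norm (jump v e x))\<^sup>2)
        + 1 / \<sigma> * seg_int e (\<lambda>x. (norm (avg (grad v) e x))\<^sup>2)"
        by (intro seg_int_lincomb seg cont)
      finally show "seg_int e (\<lambda>x. jump v e x \<bullet> avg (grad v) e x) \<le> \<dots>" .
    qed
    then show ?thesis by (simp add: sum.distrib sum_distrib_left J_def A_def)
  qed
  have N': "N' \<le> \<sigma> / 4 * J' + 1 / \<sigma> * A'"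
  proof -
    have "N' \<le> (\<Sum>r\<in>ridges. \<sigma> / 4 * (norm (ridge_jump v r))\<^sup>2 + 1 / \<sigma> * (norm (ridge_avg_tgrad v r))\<^sup>2)"
      unfolding N'_def by (intro sum_mono inner_le_weighted \<sigma>)
    then show ?thesis by (simp add: sum.distrib sum_distrib_left J'_def A'_def)
  qed
  have B: "B_form v v = X - N - N + \<sigma> * J"
    unfolding B_form_def X_def N_def J_def elem_energy_def dot_square_norm by (rule refl)
  have b: "b_form v v = X' - N' - N' + \<sigma> * J'"
    unfolding b_form_def X'_def N'_def J'_def tgrad_energy_def dot_square_norm by (rule refl)
  have "star_norm_sq v = X + \<sigma> * J + 1 / \<sigma> * A + \<alpha> * G + \<beta> * X' + \<beta> * \<sigma> * J' + \<beta> / \<sigma> * A'"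
    unfolding star_norm_sq_def X_def J_def A_def G_def X'_def J'_def A'_def elem_energy_def tgrad_energy_def
    by (rule refl)
  then have norm: "star_norm_sq v = (X + \<sigma> * J + 1 / \<sigma> * A) + \<alpha> * G + \<beta> * (X' + \<sigma> * J' + 1 / \<sigma> * A')"
    by (simp add: distrib_left)
  have "1 / 2 * (X + \<sigma> * J + 1 / \<sigma> * A) \<le> B_form v v"
    unfolding B using X(1) h_pos pos(1) \<sigma>_def \<gamma>(1) sum_avg_bound[OF v, folded A_def X_def] N
    by (rule symmetric_penalty_coercive)
  moreover have "1 / 2 * (X' + \<sigma> * J' + 1 / \<sigma> * A') \<le> b_form v v"
    unfolding b using X(2) h_pos pos(1) \<sigma>_def \<gamma>(2) sum_ridge_avg_bound[OF v, folded A'_def X'_def] N'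
    by (rule symmetric_penalty_coercive)
  then have "\<beta> * (1 / 2 * (X' + \<sigma> * J' + 1 / \<sigma> * A')) \<le> \<beta> * b_form v v"
    using pos(3) by (rule mult_left_mono)
  moreover have "\<alpha> * G \<ge> 0" using G pos by simp
  ultimately show ?thesis unfolding norm A_form_def G_def[symmetric] by argo
qed

end

section \<open>Energy estimate\<close>

lemma L2_mult_integrable:
  assumes "f \<in> L2 M" "g \<in> L2 M" shows "integrable M (\<lambda>x. f x * g x)"
proof (rule Bochner_Integration.integrable_bound)
  show "integrable M (\<lambda>x. (f x)\<^sup>2 + (g x)\<^sup>2)" using assms by (simp add: L2_def)
  have "f \<in> borel_measurable M" "g \<in> borel_measurable M" using assms by (simp_all add: L2_def)
  then show "(\<lambda>x. f x * g x) \<in> borel_measurable M" by (rule borel_measurable_times)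
  have "\<bar>s * t\<bar> \<le> s\<^sup>2 + t\<^sup>2" for s t :: real
    using sum_squares_bound[of "\<bar>s\<bar>" "\<bar>t\<bar>"] abs_ge_zero[of "s * t"]
    unfolding abs_mult power2_abs by linarith
  then show "AE x in M. norm (f x * g x) \<le> norm ((f x)\<^sup>2 + (g x)\<^sup>2)" by simp
qed

lemma ip_Young:
  assumes "f \<in> L2 M" "g \<in> L2 M" "s > 0"
  shows "ip M f g \<le> 1 / (2 * s) * ip M f f + s / 2 * ip M g g"
proof -
  have young: "x * y \<le> 1 / (2 * s) * (x * x) + s / 2 * (y * y)" for x y :: real
  proof -
    have "0 \<le> (x - s * y)\<^sup>2 / (2 * s)" using assms(3) by simp
    also have "\<dots> = 1 / (2 * s) * (x * x) + s / 2 * (y * y) - x * y"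
      using assms(3) by (simp add: power2_eq_square field_simps)
    finally show ?thesis by simp
  qed
  have "ip M f g \<le> (LINT x|M. 1 / (2 * s) * (f x * f x) + s / 2 * (g x * g x))"
    unfolding ip_def using L2_mult_integrable[OF assms(1,1)] L2_mult_integrable[OF assms(1,2)] L2_mult_integrable[OF assms(2,2)]
    by (intro integral_mono young) auto
  also have "\<dots> = 1 / (2 * s) * ip M f f + s / 2 * ip M g g"
    unfolding ip_def using L2_mult_integrable[OF assms(1,1)] L2_mult_integrable[OF assms(2,2)] by simp
  finally show ?thesis .
qed

text \<open>The implicit Euler identity \<open>(u - w) u = (u\<^sup>2 - w\<^sup>2) / 2 + (u - w)\<^sup>2 / 2\<close>, with the last square dropped.\<close>

lemma ip_difference_quotient:
  assumes "u \<in> L2 M" "w \<in> L2 M" "dt > 0"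
  shows "(ip M u u - ip M w w) / (2 * dt) \<le> ip M (\<lambda>x. (u x - w x) / dt) u"
proof -
  note int = L2_mult_integrable[OF assms(1,1)] L2_mult_integrable[OF assms(1,2)] L2_mult_integrable[OF assms(2,2)]
    L2_mult_integrable[OF assms(2,1)]
  have pt: "1 / (2 * dt) * (x * x) - 1 / (2 * dt) * (y * y) \<le> 1 / dt * (x * x) - 1 / dt * (y * x)" for x y :: real
  proof -
    have "0 \<le> (x - y)\<^sup>2 / (2 * dt)" using assms(3) by simp
    also have "\<dots> = 1 / dt * (x * x) - 1 / dt * (y * x) - (1 / (2 * dt) * (x * x) - 1 / (2 * dt) * (y * y))"
      using assms(3) by (simp add: power2_eq_square field_simps)
    finally show ?thesis by simp
  qed
  have "(ip M u u - ip M w w) / (2 * dt) = (LINT x|M. 1 / (2 * dt) * (u x * u x) - 1 / (2 * dt) * (w x * w x))"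
    unfolding ip_def using int by (simp add: diff_divide_distrib)
  also have "\<dots> \<le> (LINT x|M. 1 / dt * (u x * u x) - 1 / dt * (w x * u x))"
    using int by (intro integral_mono pt) auto
  also have "\<dots> = ip M (\<lambda>x. (u x - w x) / dt) u"
    unfolding ip_def by (rule Bochner_Integration.integral_cong) (simp_all add: diff_divide_distrib left_diff_distrib)
  finally show ?thesis .
qed

lemma ip_self_nonneg: "ip M f f \<ge> 0"
  by (simp add: ip_def)

text \<open>Summing the steps up to \<open>n\<close> bounds \<open>N n\<close> by the data plus \<open>dt / (2 T)\<close> times the sum of the \<open>N k\<close>. As there are \<open>K\<close>
  steps and \<open>K dt = T\<close>, this sum contributes at most half of the maximum of \<open>N\<close>, which is absorbed.\<close>

lemma discrete_energy_estimate:
  fixes N S F :: "nat \<Rightarrow> real"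
  assumes T: "T > 0" "dt > 0" "real K * dt = T"
    and nonneg: "\<And>k. N k \<ge> 0" "\<And>k. k \<in> {1..K} \<Longrightarrow> S k \<ge> 0" "\<And>k. F k \<ge> 0" and D: "D \<ge> 0"
    and step: "\<And>k. k < K \<Longrightarrow> (N (Suc k) - N k) / (2 * dt) + 1 / 2 * S (Suc k)
      \<le> D * F (Suc k) + 1 / (4 * T) * N (Suc k)"
  shows "N K + dt * (\<Sum>k=1..K. S k) \<le> (2 + 4 * D) * (N 0 + dt * (\<Sum>k=1..K. F k))"
proof -
  define M where "M = Max (N ` {0..K})"
  have M: "N k \<le> M" if "k \<le> K" for k unfolding M_def using that by (intro Max_ge) auto
  have M0: "M \<ge> 0" using M[of 0] nonneg(1)[of 0] by simp
  define R where "R = N 0 + 2 * D * (dt * (\<Sum>k=1..K. F k))"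
  have part: "N n + dt * (\<Sum>k=1..n. S k) \<le> N 0 + 2 * D * (dt * (\<Sum>k=1..n. F k)) + real n * (dt / (2 * T) * M)"
    if "n \<le> K" for n
    using that
  proof (induction n)
    case (Suc n)
    have "2 * dt * ((N (Suc n) - N n) / (2 * dt) + 1 / 2 * S (Suc n))
        \<le> 2 * dt * (D * F (Suc n) + 1 / (4 * T) * N (Suc n))"
      using step[of n] Suc.prems T by (intro mult_left_mono) auto
    also have "\<dots> = 2 * D * (dt * F (Suc n)) + dt / (2 * T) * N (Suc n)"
      using T by (simp add: field_simps)
    also have "\<dots> \<le> 2 * D * (dt * F (Suc n)) + dt / (2 * T) * M"
      using M[OF Suc.prems] T by (intro add_left_mono mult_left_mono) auto
    finally have "N (Suc n) - N n + dt * S (Suc n) \<le> 2 * D * (dt * F (Suc n)) + dt / (2 * T) * M"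
      using T by (simp add: distrib_left)
    moreover have "N n + dt * (\<Sum>k=1..n. S k) \<le> N 0 + 2 * D * (dt * (\<Sum>k=1..n. F k)) + real n * (dt / (2 * T) * M)"
      using Suc.IH Suc.prems by simp
    moreover have "dt * (\<Sum>k=1..Suc n. S k) = dt * (\<Sum>k=1..n. S k) + dt * S (Suc n)"
      "2 * D * (dt * (\<Sum>k=1..Suc n. F k)) = 2 * D * (dt * (\<Sum>k=1..n. F k)) + 2 * D * (dt * F (Suc n))"
      by (simp_all add: distrib_left)
    moreover have "real (Suc n) * (dt / (2 * T) * M) = real n * (dt / (2 * T) * M) + dt / (2 * T) * M"
      using distrib_right[of "real n" 1 "dt / (2 * T) * M"] by (metis mult_1_left of_nat_Suc add.commute)
    ultimately show ?case by linarith
  qed simp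
  have le: "N n + dt * (\<Sum>k=1..n. S k) \<le> R + M / 2" if n: "n \<le> K" for n
  proof -
    have "(\<Sum>k=1..n. F k) \<le> (\<Sum>k=1..K. F k)"
      using n nonneg(3) by (intro sum_mono2) auto
    then have "2 * D * (dt * (\<Sum>k=1..n. F k)) \<le> 2 * D * (dt * (\<Sum>k=1..K. F k))"
      using D T by (intro mult_left_mono) auto
    moreover have "real n * (dt / (2 * T) * M) \<le> real K * (dt / (2 * T) * M)"
      using n T M0 by (intro mult_right_mono) auto
    moreover have "real K * (dt / (2 * T) * M) = (real K * dt) / (2 * T) * M" by simp
    then have "real K * (dt / (2 * T) * M) = M / 2" using T by simp
    ultimately show ?thesis using part[OF n] unfolding R_def by linarith
  qed
  have "N n \<le> R + M / 2" if "n \<le> K" for n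
  proof -
    have "(\<Sum>k=1..n. S k) \<ge> 0" using nonneg(2) that by (intro sum_nonneg) auto
    then have "dt * (\<Sum>k=1..n. S k) \<ge> 0" using T by simp
    then show ?thesis using le[OF that] by linarith
  qed
  then have "M \<le> R + M / 2" unfolding M_def by (subst Max_le_iff) auto
  then have "N K + dt * (\<Sum>k=1..K. S k) \<le> 2 * R" using le[of K] by simp
  also have "\<dots> \<le> (2 + 4 * D) * (N 0 + dt * (\<Sum>k=1..K. F k))"
  proof -
    have "dt * (\<Sum>k=1..K. F k) \<ge> 0" using nonneg(3) T by (intro mult_nonneg_nonneg sum_nonneg) auto
    moreover have "D * N 0 \<ge> 0" using D nonneg(1) by simp
    ultimately show ?thesis by (simp add: R_def algebra_simps)
  qed
  finally show ?thesis .
qed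

context quasi_uniform_mesh
begin

lemma Gamma1_point: "x \<in> {a..b} \<Longrightarrow> y \<in> {c, d} \<Longrightarrow> (x, y) \<in> Gamma1"
  by (simp add: Gamma1_def)

lemma boundary_point_in_elem:
  assumes "z \<in> Gamma1" obtains T where "T \<in> Th" "z \<in> T"
proof -
  have "z \<in> \<Union>Th" unfolding Union_Th using assms cd by (auto simp: Gamma1_def)
  then show thesis by (rule UnionE) (rule that)
qed

lemma Vp_local_poly:
  assumes "v \<in> Vp" "T \<in> Th"
  obtains q where "slice_poly p q" "\<forall>x\<in>interior T. v x = q x" "\<forall>z. isCont q z"
proof -
  obtain q g1 g2 where ep: "element_poly p v T q g1 g2" using Vp_element_poly[OF assms] .
  have "\<forall>z. isCont q z"
    using slice_poly_continuous[OF element_poly_slice(1)[OF ep], of UNIV]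
    unfolding continuous_on_eq_continuous_at[OF open_UNIV] by simp
  moreover have "\<forall>x\<in>interior T. v x = q x" by (intro ballI element_poly_interior(1)[OF ep])
  ultimately show thesis by (intro that[OF element_poly_slice(1)[OF ep]])
qed

lemma tr_Gamma1_difference_quotient:
  assumes u: "u \<in> Vp" and w: "w \<in> Vp" and z: "z \<in> Gamma1" "z \<notin> vertices"
  shows "tr_Gamma1 (\<lambda>x. (u x - w x) / dt) z = (tr_Gamma1 u z - tr_Gamma1 w z) / dt"
proof -
  obtain T where T: "T \<in> Th" "z \<in> T" using boundary_point_in_elem[OF z(1)] .
  obtain q where q: "slice_poly p q" "\<forall>x\<in>interior T. u x = q x" "\<forall>z. isCont q z" using Vp_local_poly[OF u T(1)] .
  obtain r where r: "slice_poly p r" "\<forall>x\<in>interior T. w x = r x" "\<forall>z. isCont r z" using Vp_local_poly[OF w T(1)] .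
  have c: "isCont (\<lambda>x. (q x - r x) / dt) z"
    unfolding divide_inverse by (intro continuous_intros q(3)[rule_format] r(3)[rule_format])
  have "tr_Gamma1 (\<lambda>x. (u x - w x) / dt) z = (q z - r z) / dt"
    by (rule tr_Gamma1_eq[OF T z _ c]) (simp only: bspec[OF q(2)] bspec[OF r(2)])
  moreover have "tr_Gamma1 u z = q z" by (rule tr_Gamma1_eq[OF T z bspec[OF q(2)] q(3)[rule_format]])
  moreover have "tr_Gamma1 w z = r z" by (rule tr_Gamma1_eq[OF T z bspec[OF r(2)] r(3)[rule_format]])
  ultimately show ?thesis by (simp only:)
qed

text \<open>Above and below all other abscissae \<open>tr_Gamma1\<close> is given by a single polynomial; these finitely many are a
  null set for the integrals over \<open>Gamma1\<close>.\<close>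

definition vertex_abscissae :: "real set" where
  "vertex_abscissae = fst ` vertices \<inter> {a..b}"

lemma vertex_abscissae:
  shows "countable vertex_abscissae"
    and "x \<in> vertex_abscissae \<Longrightarrow> {x} \<in> sets (lebesgue_on {a..b})"
    and "x \<in> vertex_abscissae \<Longrightarrow> emeasure (lebesgue_on {a..b}) {x} = 0"
    and "x \<in> space (lebesgue_on {a..b}) \<Longrightarrow> x \<notin> vertex_abscissae \<Longrightarrow> y \<in> {c, d} \<Longrightarrow> (x, y) \<in> Gamma1 \<and> (x, y) \<notin> vertices"
proof -
  show "countable vertex_abscissae"
    unfolding vertex_abscissae_def using finite_vertices by (intro countable_finite) simp
  show "{x} \<in> sets (lebesgue_on {a..b})" if "x \<in> vertex_abscissae"
    using that by (simp add: vertex_abscissae_def sets_restrict_space_iff)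
  show "emeasure (lebesgue_on {a..b}) {x} = 0" if "x \<in> vertex_abscissae"
    using that by (simp add: vertex_abscissae_def emeasure_restrict_space)
  assume x: "x \<in> space (lebesgue_on {a..b})" "x \<notin> vertex_abscissae" "y \<in> {c, d}"
  then have "x \<in> {a..b}" by simp
  moreover have "(x, y) \<notin> vertices"
  proof
    assume "(x, y) \<in> vertices"
    then have "x \<in> fst ` vertices" by (intro image_eqI[of _ _ "(x, y)"]) simp_all
    then show False using x(2) \<open>x \<in> {a..b}\<close> by (simp add: vertex_abscissae_def)
  qed
  ultimately show "(x, y) \<in> Gamma1 \<and> (x, y) \<notin> vertices" using x(3) Gamma1_point by simp
qed

text \<open>Up to finitely many points the trace is the sum, over all triangles, of the local polynomial cut off to
  the triangle. That sum is bounded and measurable.\<close>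

lemma tr_Gamma1_L2:
  assumes v: "v \<in> Vp" and y: "y \<in> {c, d}"
  shows "(\<lambda>x. tr_Gamma1 v (x, y)) \<in> L2 (lebesgue_on {a..b})"
proof -
  have "\<forall>T\<in>Th. \<exists>q. slice_poly p q \<and> (\<forall>x\<in>interior T. v x = q x) \<and> (\<forall>z. isCont q z)"
  proof
    fix T assume "T \<in> Th"
    from Vp_local_poly[OF v this]
    obtain q where "slice_poly p q" "\<forall>x\<in>interior T. v x = q x" "\<forall>z. isCont q z" .
    then show "\<exists>q. slice_poly p q \<and> (\<forall>x\<in>interior T. v x = q x) \<and> (\<forall>z. isCont q z)"
      by (intro exI conjI)
  qed
  then obtain q where q: "\<forall>T\<in>Th. slice_poly p (q T) \<and> (\<forall>x\<in>interior T. v x = q T x) \<and> (\<forall>z. isCont (q T) z)"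
    by (rule bchoice[THEN exE])
  define g where "g x = (\<Sum>T\<in>Th. indicator {x. (x, y) \<in> T} x * q T (x, y))" for x
  have cont: "continuous_on S (\<lambda>x. q T (x, y))" if "T \<in> Th" for T S
  proof -
    have "slice_poly p (q T)" using bspec[OF q that] by simp
    then have "continuous_on UNIV (q T)" by (rule slice_poly_continuous)
    then show ?thesis by (rule continuous_on_compose2) (auto intro!: continuous_intros)
  qed
  have gm: "g \<in> borel_measurable (lebesgue_on {a..b})"
    unfolding g_def
  proof (intro borel_measurable_sum borel_measurable_times)
    fix T assume T: "T \<in> Th"
    have "closed ((\<lambda>x. (x, y)) -` T)"
      by (intro continuous_closed_vimage closed_elem T continuous_intros)
    then have "{x. (x, y) \<in> T} \<in> sets borel" unfolding vimage_def by (rule borel_closed)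
    then have "(indicator {x. (x, y) \<in> T} :: real \<Rightarrow> real) \<in> borel_measurable lebesgue"
      by (intro borel_measurable_indicator) simp
    then show "(indicator {x. (x, y) \<in> T} :: real \<Rightarrow> real) \<in> borel_measurable (lebesgue_on {a..b})"
      by (rule measurable_restrict_space1)
    show "(\<lambda>x. q T (x, y)) \<in> borel_measurable (lebesgue_on {a..b})"
      by (intro continuous_imp_measurable_on_sets_lebesgue cont T) simp
  qed
  have "\<forall>T\<in>Th. \<exists>B. \<forall>x\<in>{a..b}. \<bar>q T (x, y)\<bar> \<le> B"
  proof
    fix T assume "T \<in> Th"
    then have "compact ((\<lambda>x. q T (x, y)) ` {a..b})" by (intro compact_continuous_image cont) simp_all
    then have "bounded ((\<lambda>x. q T (x, y)) ` {a..b})" by (rule compact_imp_bounded)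
    then show "\<exists>B. \<forall>x\<in>{a..b}. \<bar>q T (x, y)\<bar> \<le> B" by (simp add: bounded_iff)
  qed
  then obtain B where B: "\<forall>T\<in>Th. \<forall>x\<in>{a..b}. \<bar>q T (x, y)\<bar> \<le> B T" by (rule bchoice[THEN exE])
  have gb: "\<bar>g x\<bar> \<le> (\<Sum>T\<in>Th. B T)" if x: "x \<in> {a..b}" for x
    unfolding g_def
  proof (rule order_trans[OF sum_abs], rule sum_mono)
    fix T assume T: "T \<in> Th"
    then have "\<bar>q T (x, y)\<bar> \<le> B T" using B x by blast
    then show "\<bar>indicator {x. (x, y) \<in> T} x * q T (x, y)\<bar> \<le> B T"
      using order_trans[OF abs_ge_zero, of "q T (x, y)" "B T"] by (simp add: indicator_def abs_mult)
  qed
  have eq: "tr_Gamma1 v (x, y) = g x" if x: "x \<in> space (lebesgue_on {a..b})" "x \<notin> vertex_abscissae" for x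
  proof -
    have z: "(x, y) \<in> Gamma1" "(x, y) \<notin> vertices" using vertex_abscissae(4)[OF x y] by simp_all
    obtain T where T: "T \<in> Th" "(x, y) \<in> T" using boundary_point_in_elem[OF z(1)] .
    have qT: "\<forall>x\<in>interior T. v x = q T x" "\<forall>z. isCont (q T) z" using bspec[OF q T(1)] by simp_all
    have "tr_Gamma1 v (x, y) = q T (x, y)"
      by (rule tr_Gamma1_eq[OF T z bspec[OF qT(1)] qT(2)[rule_format]])
    moreover have "g x = (\<Sum>T'\<in>Th. if T' = T then q T (x, y) else 0)"
      unfolding g_def
    proof (rule sum.cong)
      fix T' assume T': "T' \<in> Th"
      show "indicator {x. (x, y) \<in> T'} x * q T' (x, y) = (if T' = T then q T (x, y) else 0)"
      proof (cases "T' = T")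
        case False
        then have "(x, y) \<notin> T'" using boundary_elem_unique[OF T' _ T z] by blast
        then show ?thesis using False by simp
      qed (simp add: T(2))
    qed simp
    ultimately show ?thesis using T(1) finite_Th by simp
  qed
  have tm: "(\<lambda>x. tr_Gamma1 v (x, y)) \<in> borel_measurable (lebesgue_on {a..b})"
    by (rule measurable_discrete_difference[OF gm, of vertex_abscissae])
      (simp_all add: vertex_abscissae(1,2) eq)
  have "integrable (lebesgue_on {a..b}) (\<lambda>x. (g x)\<^sup>2)"
  proof (rule finite_measure.integrable_const_bound)
    show "finite_measure (lebesgue_on {a..b})" by (rule finite_measure_lebesgue_on) simp
    show "AE x in lebesgue_on {a..b}. norm ((g x)\<^sup>2) \<le> (\<Sum>T\<in>Th. B T)\<^sup>2"
    proof (rule AE_I2)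
      fix x assume "x \<in> space (lebesgue_on {a..b})"
      then have "\<bar>g x\<bar> \<le> (\<Sum>T\<in>Th. B T)" using gb by simp
      then have "\<bar>g x\<bar>\<^sup>2 \<le> (\<Sum>T\<in>Th. B T)\<^sup>2" by (rule power_mono) simp
      then show "norm ((g x)\<^sup>2) \<le> (\<Sum>T\<in>Th. B T)\<^sup>2" by simp
    qed
    show "(\<lambda>x. (g x)\<^sup>2) \<in> borel_measurable (lebesgue_on {a..b})" using gm by simp
  qed
  moreover have "integrable (lebesgue_on {a..b}) (\<lambda>x. (g x)\<^sup>2)
      = integrable (lebesgue_on {a..b}) (\<lambda>x. (tr_Gamma1 v (x, y))\<^sup>2)"
    by (rule integrable_discrete_difference[OF vertex_abscissae(1,3,2)]) (simp_all add: eq)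
  ultimately show ?thesis using tm by (simp add: L2_def)
qed

lemma ip_Gamma1_difference_quotient:
  assumes u: "u \<in> Vp" and w: "w \<in> Vp" and dt: "dt > 0"
  shows "(ip_Gamma1 (tr_Gamma1 u) (tr_Gamma1 u) - ip_Gamma1 (tr_Gamma1 w) (tr_Gamma1 w)) / (2 * dt)
    \<le> ip_Gamma1 (tr_Gamma1 (\<lambda>x. (u x - w x) / dt)) (tr_Gamma1 u)"
proof -
  let ?M = "lebesgue_on {a..b}"
  have "(ip ?M (\<lambda>x. tr_Gamma1 u (x, y)) (\<lambda>x. tr_Gamma1 u (x, y))
      - ip ?M (\<lambda>x. tr_Gamma1 w (x, y)) (\<lambda>x. tr_Gamma1 w (x, y))) / (2 * dt)
    \<le> ip ?M (\<lambda>x. tr_Gamma1 (\<lambda>x. (u x - w x) / dt) (x, y)) (\<lambda>x. tr_Gamma1 u (x, y))" if y: "y \<in> {c, d}" for y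
  proof -
    have "ip ?M (\<lambda>x. tr_Gamma1 (\<lambda>x. (u x - w x) / dt) (x, y)) (\<lambda>x. tr_Gamma1 u (x, y))
        = ip ?M (\<lambda>x. (tr_Gamma1 u (x, y) - tr_Gamma1 w (x, y)) / dt) (\<lambda>x. tr_Gamma1 u (x, y))"
      unfolding ip_def
    proof (rule integral_discrete_difference[OF vertex_abscissae(1,3,2)])
      fix x assume x: "x \<in> space ?M" "x \<notin> vertex_abscissae"
      show "tr_Gamma1 (\<lambda>x. (u x - w x) / dt) (x, y) * tr_Gamma1 u (x, y)
        = (tr_Gamma1 u (x, y) - tr_Gamma1 w (x, y)) / dt * tr_Gamma1 u (x, y)"
        using vertex_abscissae(4)[OF x y] tr_Gamma1_difference_quotient[OF u w] by simp
    qed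
    then show ?thesis
      using ip_difference_quotient[OF tr_Gamma1_L2[OF u y] tr_Gamma1_L2[OF w y] dt] by simp
  qed
  then have "(\<Sum>y\<in>{c, d}. (ip ?M (\<lambda>x. tr_Gamma1 u (x, y)) (\<lambda>x. tr_Gamma1 u (x, y))
      - ip ?M (\<lambda>x. tr_Gamma1 w (x, y)) (\<lambda>x. tr_Gamma1 w (x, y))) / (2 * dt))
    \<le> (\<Sum>y\<in>{c, d}. ip ?M (\<lambda>x. tr_Gamma1 (\<lambda>x. (u x - w x) / dt) (x, y)) (\<lambda>x. tr_Gamma1 u (x, y)))"
    by (rule sum_mono)
  then show ?thesis unfolding ip_Gamma1_def by (simp only: sum_subtractf[symmetric] sum_divide_distrib)
qed

lemma ip_Gamma1_Young:
  assumes g: "g \<in> L2_Gamma1" and v: "v \<in> Vp" and s: "s > 0"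
  shows "ip_Gamma1 g (tr_Gamma1 v) \<le> 1 / (2 * s) * ip_Gamma1 g g + s / 2 * ip_Gamma1 (tr_Gamma1 v) (tr_Gamma1 v)"
proof -
  have "ip_Gamma1 g (tr_Gamma1 v) \<le> (\<Sum>y\<in>{c, d}. 1 / (2 * s) * ip (lebesgue_on {a..b}) (\<lambda>x. g (x, y)) (\<lambda>x. g (x, y))
      + s / 2 * ip (lebesgue_on {a..b}) (\<lambda>x. tr_Gamma1 v (x, y)) (\<lambda>x. tr_Gamma1 v (x, y)))"
    unfolding ip_Gamma1_def
    using g by (intro sum_mono ip_Young tr_Gamma1_L2 v s) (auto simp: L2_Gamma1_def)
  then show ?thesis unfolding ip_Gamma1_def sum_distrib_left sum.distrib .
qed

lemma ip_Gamma1_self_nonneg: "ip_Gamma1 \<phi> \<phi> \<ge> 0"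
  unfolding ip_Gamma1_def by (intro sum_nonneg ip_self_nonneg)

lemma star_norm_sq_nonneg:
  assumes "\<gamma> > 0" "\<alpha> \<ge> 0" "\<beta> \<ge> 0" shows "star_norm_sq v \<ge> 0"
proof -
  have "\<sigma> > 0" using assms h_pos by (simp add: \<sigma>_def)
  then show ?thesis unfolding star_norm_sq_def using assms
    by (intro add_nonneg_nonneg mult_nonneg_nonneg sum_nonneg ip_Gamma1_self_nonneg
        seg_int_nonneg is_segment_edge E_star_edges E_Gamma1_edges) simp_all
qed

text \<open>The scheme tested with its own solution. Young's inequality with the weight \<open>s\<close> moves the solution part
  of both source terms into \<open>L2lam_norm_sq\<close>, for the boundary source with \<open>s * lam\<close> in place of \<open>s\<close>.\<close>

lemma energy_step:
  assumes pos: "\<gamma> > 0" "\<alpha> \<ge> 0" "\<beta> \<ge> 0" "lam > 0"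
    and \<gamma>: "8 * avg_const p \<rho> \<le> \<gamma>" "8 * ridge_const p \<rho> \<le> \<gamma>"
    and u: "u \<in> Vp" and w: "w \<in> Vp" and dt: "dt > 0" and s: "s > 0"
    and f: "f \<in> L2 (lebesgue_on Omega)" and g: "g \<in> L2_Gamma1"
    and eq: "ip_Omega (\<lambda>x. (u x - w x) / dt) u
       + lam * ip_Gamma1 (tr_Gamma1 (\<lambda>x. (u x - w x) / dt)) (tr_Gamma1 u) + A_form u u
       = ip_Omega f u + ip_Gamma1 g (tr_Gamma1 u)"
  shows "(L2lam_norm_sq u - L2lam_norm_sq w) / (2 * dt) + 1 / 2 * star_norm_sq u
    \<le> (1 / (2 * s) + 1 / (2 * s * lam)) * (ip_Omega f f + ip_Gamma1 g g) + s / 2 * L2lam_norm_sq u"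
proof -
  have L2: "u \<in> L2 (lebesgue_on Omega)" "w \<in> L2 (lebesgue_on Omega)"
    using u w by (simp_all add: Vp_def)
  have 1: "(ip_Omega u u - ip_Omega w w) / (2 * dt) \<le> ip_Omega (\<lambda>x. (u x - w x) / dt) u"
    unfolding ip_Omega_def by (rule ip_difference_quotient[OF L2 dt])
  have 2: "lam * ((ip_Gamma1 (tr_Gamma1 u) (tr_Gamma1 u) - ip_Gamma1 (tr_Gamma1 w) (tr_Gamma1 w)) / (2 * dt))
    \<le> lam * ip_Gamma1 (tr_Gamma1 (\<lambda>x. (u x - w x) / dt)) (tr_Gamma1 u)"
    using pos by (intro mult_left_mono ip_Gamma1_difference_quotient u w dt) simp
  have 3: "ip_Omega f u \<le> 1 / (2 * s) * ip_Omega f f + s / 2 * ip_Omega u u"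
    unfolding ip_Omega_def by (rule ip_Young[OF f L2(1) s])
  have 4: "ip_Gamma1 g (tr_Gamma1 u) \<le> 1 / (2 * (s * lam)) * ip_Gamma1 g g
      + s * lam / 2 * ip_Gamma1 (tr_Gamma1 u) (tr_Gamma1 u)"
    using s pos by (intro ip_Gamma1_Young g u) simp
  have 5: "1 / 2 * star_norm_sq u \<le> A_form u u" by (rule A_form_coercive[OF u pos(1-3) \<gamma>])
  have "0 \<le> 1 / (2 * s) * ip_Gamma1 g g" "0 \<le> 1 / (2 * s * lam) * ip_Omega f f"
    using s pos ip_Gamma1_self_nonneg by (simp_all add: ip_Omega_def ip_self_nonneg)
  then have 6: "1 / (2 * s) * ip_Omega f f + 1 / (2 * (s * lam)) * ip_Gamma1 g g
      \<le> (1 / (2 * s) + 1 / (2 * s * lam)) * (ip_Omega f f + ip_Gamma1 g g)"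
    by (simp add: distrib_left distrib_right mult.assoc)
  have 7: "(L2lam_norm_sq u - L2lam_norm_sq w) / (2 * dt) = (ip_Omega u u - ip_Omega w w) / (2 * dt)
      + lam * ((ip_Gamma1 (tr_Gamma1 u) (tr_Gamma1 u) - ip_Gamma1 (tr_Gamma1 w) (tr_Gamma1 w)) / (2 * dt))"
    by (simp add: L2lam_norm_sq_def diff_divide_distrib add_divide_distrib right_diff_distrib)
  have 8: "s / 2 * L2lam_norm_sq u = s / 2 * ip_Omega u u + s * lam / 2 * ip_Gamma1 (tr_Gamma1 u) (tr_Gamma1 u)"
    by (simp add: L2lam_norm_sq_def distrib_left)
  show ?thesis unfolding 7 8 using 1 2 3 4 5 6 eq by linarith
qed

lemma L2lam_norm_sq_nonneg: "lam \<ge> 0 \<Longrightarrow> L2lam_norm_sq v \<ge> 0"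
  unfolding L2lam_norm_sq_def ip_Omega_def
  by (intro add_nonneg_nonneg mult_nonneg_nonneg ip_self_nonneg ip_Gamma1_self_nonneg)

text \<open>The weight in Young's inequality is \<open>s = 1 / (2 T)\<close>, the value that the summation in time can absorb.\<close>

lemma fd_stability:
  assumes pos: "\<gamma> > 0" "\<alpha> \<ge> 0" "\<beta> \<ge> 0" "lam > 0"
    and \<gamma>: "8 * avg_const p \<rho> \<le> \<gamma>" "8 * ridge_const p \<rho> \<le> \<gamma>"
    and T: "T > 0" "dt > 0" "real K * dt = T"
    and f: "\<And>t. t \<in> {0..T} \<Longrightarrow> f t \<in> L2 (lebesgue_on Omega)" and g: "\<And>t. t \<in> {0..T} \<Longrightarrow> g t \<in> L2_Gamma1"
    and sol: "fd_solution dt K f g u0 u"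
  shows "L2lam_norm_sq (u K) + dt * (\<Sum>k=1..K. star_norm_sq (u k))
    \<le> (2 + 4 * (T + T / lam)) * (L2lam_norm_sq (u 0) + dt * (\<Sum>k=1..K.
        ip_Omega (f (real k * dt)) (f (real k * dt)) + ip_Gamma1 (g (real k * dt)) (g (real k * dt))))"
proof (rule discrete_energy_estimate[where N = "\<lambda>k. L2lam_norm_sq (u k)" and S = "\<lambda>k. star_norm_sq (u k)"
      and F = "\<lambda>k. ip_Omega (f (real k * dt)) (f (real k * dt)) + ip_Gamma1 (g (real k * dt)) (g (real k * dt))"
      and D = "T + T / lam", OF T])
  have Vp: "u k \<in> Vp" if "k \<le> K" for k
    using sol that unfolding fd_solution_def L2_projection_def by (cases k) auto
  fix k
  show "L2lam_norm_sq (u k) \<ge> 0" using pos by (intro L2lam_norm_sq_nonneg) simp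
  show "star_norm_sq (u k) \<ge> 0" by (rule star_norm_sq_nonneg[OF pos(1-3)])
  show "ip_Omega (f (real k * dt)) (f (real k * dt)) + ip_Gamma1 (g (real k * dt)) (g (real k * dt)) \<ge> 0"
    unfolding ip_Omega_def by (intro add_nonneg_nonneg ip_self_nonneg ip_Gamma1_self_nonneg)
  show "T + T / lam \<ge> 0" using T pos by simp
  assume k: "k < K"
  define t where "t = real (Suc k) * dt"
  have "real (Suc k) * dt \<le> real K * dt" using k T by (intro mult_right_mono) auto
  then have t: "t \<in> {0..T}" using T by (simp add: t_def)
  have s: "1 / (2 * T) > 0" using T by simp
  have V: "u (Suc k) \<in> Vp" "u k \<in> Vp" using Vp k by simp_all
  have "ip_Omega (\<lambda>x. (u (Suc k) x - u k x) / dt) (u (Suc k))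
       + lam * ip_Gamma1 (tr_Gamma1 (\<lambda>x. (u (Suc k) x - u k x) / dt)) (tr_Gamma1 (u (Suc k)))
       + A_form (u (Suc k)) (u (Suc k))
       = ip_Omega (f t) (u (Suc k)) + ip_Gamma1 (g t) (tr_Gamma1 (u (Suc k)))"
    using sol k V(1) unfolding fd_solution_def t_def by blast
  from energy_step[OF pos \<gamma> V T(2) s f[OF t] g[OF t] this]
  show "(L2lam_norm_sq (u (Suc k)) - L2lam_norm_sq (u k)) / (2 * dt) + 1 / 2 * star_norm_sq (u (Suc k))
    \<le> (T + T / lam) * (ip_Omega (f (real (Suc k) * dt)) (f (real (Suc k) * dt))
        + ip_Gamma1 (g (real (Suc k) * dt)) (g (real (Suc k) * dt))) + 1 / (4 * T) * L2lam_norm_sq (u (Suc k))"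
    unfolding t_def by simp
qed

end

theorem lemma5p1:
  fixes a b c d T \<alpha> \<beta> lam \<rho> :: real and p :: nat
  assumes "a < b" and "c < d"
    and "T > 0" and "\<alpha> > 0" and "\<beta> > 0" and "lam > 0" and "p \<ge> 1" and "\<rho> > 0"
  shows "\<exists>\<gamma>0>0. \<forall>\<gamma>\<ge>\<gamma>0. \<exists>C>0.
    \<forall>(Th :: point set set) (dt :: real) (K :: nat) f g u0 u.
      dg_setting.conforming_mesh a b c d Th \<longrightarrow>
      dg_setting.quasi_uniform Th \<rho> \<longrightarrow>
      dt > 0 \<longrightarrow> real K * dt = T \<longrightarrow>
      f \<in> C_into T (L2 (lebesgue_on (dg_setting.Omega a b c d)))
            (\<lambda>\<phi>. dg_setting.ip_Omega a b c d \<phi> \<phi>) \<longrightarrow>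
      g \<in> C_into T (dg_setting.L2_Gamma1 a b c d)
            (\<lambda>\<phi>. dg_setting.ip_Gamma1 a b c d \<phi> \<phi>) \<longrightarrow>
      u0 \<in> L2 (lebesgue_on (dg_setting.Omega a b c d)) \<longrightarrow>
      dg_setting.fd_solution a b c d \<alpha> \<beta> lam \<gamma> p Th dt K f g u0 u \<longrightarrow>
      dg_setting.L2lam_norm_sq a b c d lam Th (u K)
        + dt * (\<Sum>k=1..K. dg_setting.star_norm_sq a b c d \<alpha> \<beta> \<gamma> Th (u k))
      \<le> C * (dg_setting.L2lam_norm_sq a b c d lam Th (u 0)
        + dt * (\<Sum>k=1..K.
            dg_setting.ip_Omega a b c d (f (real k * dt)) (f (real k * dt))
            + dg_setting.ip_Gamma1 a b c d (g (real k * dt)) (g (real k * dt))))"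
proof -
  define \<gamma>0 where "\<gamma>0 = max 1 (max (8 * avg_const p \<rho>) (8 * ridge_const p \<rho>))"
  have "\<gamma>0 > 0" by (simp add: \<gamma>0_def)
  moreover have "\<exists>C>0. \<forall>(Th :: point set set) (dt :: real) (K :: nat) f g u0 u.
      dg_setting.conforming_mesh a b c d Th \<longrightarrow>
      dg_setting.quasi_uniform Th \<rho> \<longrightarrow>
      dt > 0 \<longrightarrow> real K * dt = T \<longrightarrow>
      f \<in> C_into T (L2 (lebesgue_on (dg_setting.Omega a b c d)))
            (\<lambda>\<phi>. dg_setting.ip_Omega a b c d \<phi> \<phi>) \<longrightarrow>
      g \<in> C_into T (dg_setting.L2_Gamma1 a b c d)
            (\<lambda>\<phi>. dg_setting.ip_Gamma1 a b c d \<phi> \<phi>) \<longrightarrow>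
      u0 \<in> L2 (lebesgue_on (dg_setting.Omega a b c d)) \<longrightarrow>
      dg_setting.fd_solution a b c d \<alpha> \<beta> lam \<gamma> p Th dt K f g u0 u \<longrightarrow>
      dg_setting.L2lam_norm_sq a b c d lam Th (u K)
        + dt * (\<Sum>k=1..K. dg_setting.star_norm_sq a b c d \<alpha> \<beta> \<gamma> Th (u k))
      \<le> C * (dg_setting.L2lam_norm_sq a b c d lam Th (u 0)
        + dt * (\<Sum>k=1..K.
            dg_setting.ip_Omega a b c d (f (real k * dt)) (f (real k * dt))
            + dg_setting.ip_Gamma1 a b c d (g (real k * dt)) (g (real k * dt))))"
    if \<gamma>: "\<gamma> \<ge> \<gamma>0" for \<gamma>
  proof (rule exI[of _ "2 + 4 * (T + T / lam)"], rule conjI, goal_cases)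
    case 1
    show ?case using assms by (simp add: add_pos_pos)
  next
    case 2
    show ?case
    proof (intro allI impI)
      fix Th :: "point set set" and dt K f g u0 u
      assume mesh: "dg_setting.conforming_mesh a b c d Th" "dg_setting.quasi_uniform Th \<rho>"
        and dt: "dt > 0" "real K * dt = T"
        and f: "f \<in> C_into T (L2 (lebesgue_on (dg_setting.Omega a b c d))) (\<lambda>\<phi>. dg_setting.ip_Omega a b c d \<phi> \<phi>)"
        and g: "g \<in> C_into T (dg_setting.L2_Gamma1 a b c d) (\<lambda>\<phi>. dg_setting.ip_Gamma1 a b c d \<phi> \<phi>)"
        and sol: "dg_setting.fd_solution a b c d \<alpha> \<beta> lam \<gamma> p Th dt K f g u0 u"
      interpret quasi_uniform_mesh a b c d \<alpha> \<beta> lam \<gamma> p Th \<rho>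
        using assms mesh by unfold_locales
      show "L2lam_norm_sq (u K) + dt * (\<Sum>k=1..K. star_norm_sq (u k))
        \<le> (2 + 4 * (T + T / lam)) * (L2lam_norm_sq (u 0) + dt * (\<Sum>k=1..K.
          ip_Omega (f (real k * dt)) (f (real k * dt)) + ip_Gamma1 (g (real k * dt)) (g (real k * dt))))"
        using assms \<gamma> f g
        by (intro fd_stability[OF _ _ _ _ _ _ _ dt _ _ sol]) (auto simp: \<gamma>0_def C_into_def)
    qed
  qed
  ultimately show ?thesis by blast
qed

end
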